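(* Fix $(\mu,\nu)\in\boldsymbol{\mathcal P}$. For every boundary datum $\varphi\in C([0,1],\mathcal P([0,1]))$ the following problem has a solution, and this solution is unique: find a continuous map $G:\mathbb S\to\mathcal P([0,1])$ such that for all $(x,y)\in\mathbb S$ $$x\int_0^\beta \big(G(x,y)-G(x+k,y)\big)\mu(dk)+y\int_0^\beta\big(G(x,y)-G(x,y+k)\big)\nu(dk)=0,$$ $G(0,y)=\varphi(0)$ for $y>0$, $G(x,0)=\varphi(1)$ for $x>0$, and $d_W\big(G(x,y),\varphi(\tfrac{x}{x+y})\big)\to 0$ as $x+y\to\infty$. Moreover, the solution depends continuously on the boundary datum: denoting the solution by $G^\varphi_{(\mu,\nu)}$, the map $\varphi\mapsto G^\varphi_{(\mu,\nu)}$ is continuous from $(C([0,1],\mathcal P([0,1])),d_\infty)$ to $(C(\mathbb S,\mathcal P([0,1])),d)$.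
   Context: $\mathcal P([0,\beta])$ denotes the set of Borel probability measures on $[0,\beta]$, endowed with the 1-Wasserstein metric $d_W(\xi_1,\xi_2)=\int_0^\beta|F_{\xi_1}(t)-F_{\xi_2}(t)|\,dt$ ($F_\xi$ the distribution function). Fix constants $0<m_0\le\beta<\infty$. $\boldsymbol{\mathcal P}$ is the set of pairs $(\mu,\nu)$ of probability measures on $[0,\beta]$ with $\int_0^\beta k\,\mu(dk)=\int_0^\beta k\,\nu(dk)\ge m_0$. $\mathbb S=[0,\infty)\times[0,\infty)\setminus\{(0,0)\}$. A boundary datum is a continuous map $\varphi:[0,1]\to(\mathcal P([0,1]),d_W)$; on such maps $d_\infty(\varphi_1,\varphi_2)=\sup_{t\in[0,1]}d_W(\varphi_1(t),\varphi_2(t))$. The functional equation is an identity between finite signed measures on $[0,1]$ (integrals of measure-valued maps taken setwise). $C(\mathbb S,\mathcal P([0,1]))$ is the set of continuous maps $\mathbb S\to(\mathcal P([0,1]),d_W)$, with metric $d(G_1,G_2)=\sum_{n\ge1}2^{-n}\frac{d_n(G_1,G_2)}{1+d_n(G_1,G_2)}$, where $d_n(G_1,G_2)=\sup\{d_W(G_1(x,y),G_2(x,y)):(x,y)\in\mathbb S,\ x+y\ge 1/n\}$. *)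

theory Defs
  imports "HOL-Probability.Probability"
begin

definition Prob_on :: "real \<Rightarrow> real \<Rightarrow> real measure set" where
  "Prob_on a b = {M. prob_space M \<and> sets M = sets (restrict_space borel {a..b})}"

text \<open>1-Wasserstein distance on P([0,1]) via distribution functions F(t) = M([0,t]).\<close>
definition dW :: "real measure \<Rightarrow> real measure \<Rightarrow> real" where
  "dW M N = integral {0..1} (\<lambda>t. \<bar>measure M {0..t} - measure N {0..t}\<bar>)"

definition S_set :: "(real \<times> real) set" where
  "S_set = {(x, y). x \<ge> 0 \<and> y \<ge> 0 \<and> (x, y) \<noteq> (0, 0)}"

definition boundary_datum :: "(real \<Rightarrow> real measure) \<Rightarrow> bool" where
  "boundary_datum \<phi> \<longleftrightarrow> (\<forall>t\<in>{0..1}. \<phi> t \<in> Prob_on 0 1) \<and>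
     (\<forall>t\<in>{0..1}. \<forall>e>0. \<exists>d>0. \<forall>s\<in>{0..1}. \<bar>s - t\<bar> < d \<longrightarrow> dW (\<phi> s) (\<phi> t) < e)"

definition d_infty :: "(real \<Rightarrow> real measure) \<Rightarrow> (real \<Rightarrow> real measure) \<Rightarrow> real" where
  "d_infty \<phi>1 \<phi>2 = (SUP t\<in>{0..1}. dW (\<phi>1 t) (\<phi>2 t))"

definition cont_S :: "(real \<times> real \<Rightarrow> real measure) \<Rightarrow> bool" where
  "cont_S G \<longleftrightarrow> (\<forall>p\<in>S_set. G p \<in> Prob_on 0 1) \<and>
     (\<forall>p\<in>S_set. \<forall>e>0. \<exists>d>0. \<forall>q\<in>S_set. dist q p < d \<longrightarrow> dW (G q) (G p) < e)"

definition d_n :: "nat \<Rightarrow> (real \<times> real \<Rightarrow> real measure) \<Rightarrow> (real \<times> real \<Rightarrow> real measure) \<Rightarrow> real" where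
  "d_n n G1 G2 = (SUP p\<in>{p\<in>S_set. fst p + snd p \<ge> 1 / real n}. dW (G1 p) (G2 p))"

definition d_S :: "(real \<times> real \<Rightarrow> real measure) \<Rightarrow> (real \<times> real \<Rightarrow> real measure) \<Rightarrow> real" where
  "d_S G1 G2 = (\<Sum>n. (1/2) ^ (Suc n) * (d_n (Suc n) G1 G2 / (1 + d_n (Suc n) G1 G2)))"

text \<open>Solution of the boundary value problem for data (mu, nu) and boundary datum phi.
  The functional equation is an identity of finite signed measures on [0,1], i.e. it
  holds evaluated on every Borel subset A of [0,1].\<close>
definition is_solution ::
  "real measure \<Rightarrow> real measure \<Rightarrow> (real \<Rightarrow> real measure) \<Rightarrow> (real \<times> real \<Rightarrow> real measure) \<Rightarrow> bool" where
  "is_solution \<mu> \<nu> \<phi> G \<longleftrightarrow> cont_S G \<and>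
     (\<forall>(x, y)\<in>S_set. \<forall>A\<in>sets (restrict_space borel {0..1::real}).
        x * (LINT k|\<mu>. measure (G (x, y)) A - measure (G (x + k, y)) A)
      + y * (LINT k|\<nu>. measure (G (x, y)) A - measure (G (x, y + k)) A) = 0) \<and>
     (\<forall>y>0. G (0, y) = \<phi> 0) \<and> (\<forall>x>0. G (x, 0) = \<phi> 1) \<and>
     (\<forall>e>0. \<exists>R. \<forall>(x, y)\<in>S_set. x + y \<ge> R \<longrightarrow> dW (G (x, y)) (\<phi> (x / (x + y))) < e)"

end

theory Submission
  imports Defs "HOL-Computational_Algebra.Polynomial"
begin

text \<open>
  The functional equation says that \<^term>\<open>G\<close> is harmonic for a two-colour urn: \<^term>\<open>G\<close> equals
  its average after one step, where from \<open>(x, y)\<close> a step increases the first coordinate by a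
  \<open>\<mu>\<close>-distributed amount with probability \<open>x/(x+y)\<close>, and the second coordinate by a
  \<open>\<nu>\<close>-distributed amount otherwise. For two harmonic maps the Wasserstein distance is a
  subharmonic function. Since \<open>exp (-(x+y))\<close> is contracted by the step operator, a maximum
  principle holds: a bounded subharmonic function is bounded by its limit superior at infinity. This
  gives uniqueness, and the solution is 1-Lipschitz in the boundary datum.

  For existence, let first the boundary datum be a polynomial \<open>f\<close>. Because the two means agree, the
  proportion \<open>x/(x+y)\<close> is a martingale up to an error \<open>O((x+y)^-2)\<close>, so that one step changes
  \<open>f(x/(x+y))\<close> by at most a constant times the expected decrease of \<open>1/(1+x+y)\<close>. Telescoping,
  the iterates of the step operator converge uniformly to a harmonic function. Applied to the
  Bernstein polynomials this yields harmonic weights \<open>h\<^sub>n\<^sub>k\<close>, and \<open>\<Sum>k. h\<^sub>n\<^sub>k \<phi>(k/n)\<close> solves the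
  problem for the Bernstein approximation of \<open>\<phi>\<close>. By the maximum principle these maps are uniformly
  Cauchy, and their limit solves the problem for \<open>\<phi>\<close>.
\<close>

section \<open>The step operator of the urn\<close>

lemma Prob_onD:
  assumes "M \<in> Prob_on a b"
  shows "prob_space M" "sets M = sets (restrict_space borel {a..b})" "space M = {a..b}"
proof -
  show 1: "prob_space M" "sets M = sets (restrict_space borel {a..b})"
    using assms by (auto simp: Prob_on_def)
  show "space M = {a..b}"
    using sets_eq_imp_space_eq[OF 1(2)] by (simp add: space_restrict_space)
qed

section \<open>Bounded functions on the punctured quadrant and their averages over one
  increment\<close>

definition bc :: "(real \<times> real \<Rightarrow> real) \<Rightarrow> bool" where
  "bc f \<longleftrightarrow> continuous_on S_set f \<and> bounded (f ` S_set)"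

text \<open>Continuity is too much to ask of \<open>p \<mapsto> measure (G p) A\<close>: a map that
  is continuous for the Wasserstein metric need not have continuous values on a fixed Borel set.
  Averages are therefore set up for measurable functions, and \<open>bc\<close> is reserved for
  uniform limits and the maximum principle.\<close>

definition bm :: "(real \<times> real \<Rightarrow> real) \<Rightarrow> bool" where
  "bm f \<longleftrightarrow> f \<in> borel_measurable (restrict_space borel S_set) \<and> bounded (f ` S_set)"

text \<open>The direction \<open>e\<close> will be \<open>(1, 0)\<close> or \<open>(0, 1)\<close>,
  so one development serves both colours.\<close>

definition avg :: "real measure \<Rightarrow> real \<times> real \<Rightarrow> (real \<times> real \<Rightarrow> real) \<Rightarrow> real \<times> real \<Rightarrow> real" where
  "avg M e f p = (\<integral>k. f (p + k *\<^sub>R e) \<partial>M)"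

lemma bc_imp_bm: "bc f \<Longrightarrow> bm f"
  by (auto simp: bc_def bm_def intro: borel_measurable_continuous_on_restrict)

lemma bcI: "continuous_on S_set f \<Longrightarrow> (\<And>p. p \<in> S_set \<Longrightarrow> \<bar>f p\<bar> \<le> C) \<Longrightarrow> bc f"
  unfolding bc_def bounded_iff by fastforce

lemma bmI: "f \<in> borel_measurable (restrict_space borel S_set) \<Longrightarrow>
    (\<And>p. p \<in> S_set \<Longrightarrow> \<bar>f p\<bar> \<le> C) \<Longrightarrow> bm f"
  unfolding bm_def bounded_iff by fastforce

lemma bmD:
  assumes "bm f"
  obtains C where "C \<ge> 0" "\<And>p. p \<in> S_set \<Longrightarrow> \<bar>f p\<bar> \<le> C"
proof -
  obtain C where "\<And>p. p \<in> S_set \<Longrightarrow> \<bar>f p\<bar> \<le> C"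
    using assms by (auto simp: bm_def bounded_iff)
  then have "max C 0 \<ge> 0" "\<And>p. p \<in> S_set \<Longrightarrow> \<bar>f p\<bar> \<le> max C 0"
    by (auto intro: max.coboundedI1)
  then show ?thesis by (rule that)
qed

lemma bm_add: "bm f \<Longrightarrow> bm g \<Longrightarrow> bm (\<lambda>p. f p + g p)"
  by (auto simp: bm_def intro!: bounded_plus_comp)
lemma bm_diff: "bm f \<Longrightarrow> bm g \<Longrightarrow> bm (\<lambda>p. f p - g p)"
  by (auto simp: bm_def intro!: bounded_minus_comp)
lemma bm_cmult: "bm f \<Longrightarrow> bm (\<lambda>p. c * f p)"
  using bounded_scaling[of "f ` S_set" c] by (auto simp: bm_def image_image)
lemma bm_const: "bm (\<lambda>p. c)"
  by (rule bmI[of _ "\<bar>c\<bar>"]) auto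
lemma bm_abs: "bm f \<Longrightarrow> bm (\<lambda>p. \<bar>f p\<bar>)"
  by (auto simp: bm_def bounded_iff)

lemma bc_const: "bc (\<lambda>p. c)"
  by (rule bcI[of _ "\<bar>c\<bar>"]) auto
lemma bc_add: "bc f \<Longrightarrow> bc g \<Longrightarrow> bc (\<lambda>p. f p + g p)"
  by (auto simp: bc_def intro!: bounded_plus_comp continuous_on_add)
lemma bc_diff: "bc f \<Longrightarrow> bc g \<Longrightarrow> bc (\<lambda>p. f p - g p)"
  by (auto simp: bc_def intro!: bounded_minus_comp continuous_on_diff)
lemma bc_sum: "(\<And>i. i \<in> I \<Longrightarrow> bc (f i)) \<Longrightarrow> bc (\<lambda>p. \<Sum>i\<in>I. f i p)"
  by (induction I rule: infinite_finite_induct) (auto intro: bc_add bc_const)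

lemma S_set_iff: "p \<in> S_set \<longleftrightarrow> fst p \<ge> 0 \<and> snd p \<ge> 0 \<and> fst p + snd p > 0"
  by (cases p) (auto simp: S_set_def)

lemma shift_in_S_set:
  "p \<in> S_set \<Longrightarrow> k \<ge> 0 \<Longrightarrow> fst e \<ge> 0 \<Longrightarrow> snd e \<ge> 0 \<Longrightarrow> p + k *\<^sub>R e \<in> S_set"
  by (auto simp: S_set_iff add_nonneg_nonneg add_pos_nonneg)
     (metis add_pos_nonneg add.commute add.left_commute add_nonneg_nonneg mult_nonneg_nonneg)

context
  fixes \<beta> :: real and M :: "real measure" and e :: "real \<times> real"
  assumes M: "M \<in> Prob_on 0 \<beta>" and e: "fst e \<ge> 0" "snd e \<ge> 0"
begin

interpretation prob_space M using Prob_onD(1)[OF M] .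

lemma shift_measurable:
  assumes "p \<in> S_set"
  shows "(\<lambda>k. p + k *\<^sub>R e) \<in> measurable M (restrict_space borel S_set)"
proof (rule measurable_restrict_space2)
  show "(\<lambda>k. p + k *\<^sub>R e) \<in> space M \<rightarrow> S_set"
    using shift_in_S_set[OF assms _ e] Prob_onD(3)[OF M] by auto
  have "(\<lambda>k. p + k *\<^sub>R e) \<in> measurable (restrict_space borel {0..\<beta>}) borel"
    by (intro measurable_restrict_space1) auto
  then show "(\<lambda>k. p + k *\<^sub>R e) \<in> measurable M borel"
    using measurable_cong_sets[OF Prob_onD(2)[OF M] refl] by auto
qed

lemma shift_bound:
  assumes "p \<in> S_set" "k \<in> space M"
  shows "p + k *\<^sub>R e \<in> S_set"
  using shift_in_S_set[OF assms(1) _ e] assms(2) Prob_onD(3)[OF M] by auto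

lemma shift_integrable:
  assumes "bm f" "p \<in> S_set"
  shows "integrable M (\<lambda>k. f (p + k *\<^sub>R e))"
proof -
  obtain C where C: "\<And>p. p \<in> S_set \<Longrightarrow> \<bar>f p\<bar> \<le> C" using bmD[OF assms(1)] by metis
  have "(\<lambda>k. f (p + k *\<^sub>R e)) \<in> borel_measurable M"
    using assms measurable_compose[OF shift_measurable[OF assms(2)]] unfolding bm_def by blast
  then show ?thesis
    using C shift_bound[OF assms(2)]
    by (intro integrable_const_bound[where B=C]) auto
qed

lemma avg_add: "bm f \<Longrightarrow> bm g \<Longrightarrow> p \<in> S_set \<Longrightarrow>
    avg M e (\<lambda>q. f q + g q) p = avg M e f p + avg M e g p"
  unfolding avg_def by (rule Bochner_Integration.integral_add) (auto intro: shift_integrable)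
lemma avg_diff: "bm f \<Longrightarrow> bm g \<Longrightarrow> p \<in> S_set \<Longrightarrow>
    avg M e (\<lambda>q. f q - g q) p = avg M e f p - avg M e g p"
  unfolding avg_def by (rule Bochner_Integration.integral_diff) (auto intro: shift_integrable)
lemma avg_cmult: "avg M e (\<lambda>q. c * f q) p = c * avg M e f p"
  unfolding avg_def by simp
lemma avg_const: "avg M e (\<lambda>q. c) p = c"
  unfolding avg_def by (simp add: prob_space)
lemma avg_sum: "(\<And>i. i \<in> I \<Longrightarrow> bm (f i)) \<Longrightarrow> p \<in> S_set \<Longrightarrow>
    avg M e (\<lambda>q. \<Sum>i\<in>I. f i q) p = (\<Sum>i\<in>I. avg M e (f i) p)"
  unfolding avg_def by (rule Bochner_Integration.integral_sum) (auto intro: shift_integrable)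
lemma avg_mono: "bm f \<Longrightarrow> bm g \<Longrightarrow> p \<in> S_set \<Longrightarrow> (\<And>q. q \<in> S_set \<Longrightarrow> f q \<le> g q) \<Longrightarrow>
    avg M e f p \<le> avg M e g p"
  unfolding avg_def using shift_bound[of p]
  by (intro integral_mono shift_integrable) blast+

text \<open>Dominated convergence along sequences; the global bound of \<open>f\<close> is the
  dominating constant.\<close>

lemma avg_continuous:
  assumes "bc f"
  shows "continuous_on S_set (avg M e f)"
proof (rule continuous_on_sequentiallyI)
  fix u :: "nat \<Rightarrow> real \<times> real" and a
  assume u: "\<forall>n. u n \<in> S_set" and a: "a \<in> S_set" and lim: "u \<longlonglongrightarrow> a"
  obtain C where C: "\<And>p. p \<in> S_set \<Longrightarrow> \<bar>f p\<bar> \<le> C" using bmD[OF bc_imp_bm[OF assms]] by metis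
  show "(\<lambda>n. avg M e f (u n)) \<longlonglongrightarrow> avg M e f a"
    unfolding avg_def
  proof (rule integral_dominated_convergence[where w="\<lambda>_. C"])
    show "(\<lambda>k. f (a + k *\<^sub>R e)) \<in> borel_measurable M"
      "(\<lambda>k. f (u n + k *\<^sub>R e)) \<in> borel_measurable M" for n
      using shift_integrable[OF bc_imp_bm[OF assms]] u a by auto
    show "integrable M (\<lambda>_. C)" by simp
    show "AE k in M. (\<lambda>n. f (u n + k *\<^sub>R e)) \<longlonglongrightarrow> f (a + k *\<^sub>R e)"
    proof (rule AE_I2)
      fix k assume k: "k \<in> space M"
      have "(\<lambda>n. u n + k *\<^sub>R e) \<longlonglongrightarrow> a + k *\<^sub>R e" by (intro tendsto_intros lim)
      moreover have "continuous_on S_set f" using assms by (simp add: bc_def)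
      ultimately show "(\<lambda>n. f (u n + k *\<^sub>R e)) \<longlonglongrightarrow> f (a + k *\<^sub>R e)"
        using shift_bound[OF a k] shift_bound[OF u[rule_format] k]
        by (auto simp: continuous_on_sequentially o_def)
    qed
    show "AE k in M. norm (f (u n + k *\<^sub>R e)) \<le> C" for n
      using C shift_bound[OF u[rule_format]] by auto
  qed
qed

end

section \<open>The one-step operator as a positive operator that fixes constants\<close>

locale urn =
  fixes \<beta> m :: real and \<mu> \<nu> :: "real measure"
  assumes mu: "\<mu> \<in> Prob_on 0 \<beta>" and nu: "\<nu> \<in> Prob_on 0 \<beta>"
    and mean_mu: "(\<integral>k. k \<partial>\<mu>) = m" and mean_nu: "(\<integral>k. k \<partial>\<nu>) = m"
    and m_pos: "0 < m" and beta_pos: "0 < \<beta>"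
begin

definition step :: "(real \<times> real \<Rightarrow> real) \<Rightarrow> real \<times> real \<Rightarrow> real" where
  "step f p = (fst p * avg \<mu> (1, 0) f p + snd p * avg \<nu> (0, 1) f p) / (fst p + snd p)"

lemma step_add: "bm f \<Longrightarrow> bm g \<Longrightarrow> p \<in> S_set \<Longrightarrow>
    step (\<lambda>q. f q + g q) p = step f p + step g p"
  by (simp add: step_def avg_add[OF mu] avg_add[OF nu] add_divide_distrib[symmetric] algebra_simps)
lemma step_diff: "bm f \<Longrightarrow> bm g \<Longrightarrow> p \<in> S_set \<Longrightarrow>
    step (\<lambda>q. f q - g q) p = step f p - step g p"
  by (simp add: step_def avg_diff[OF mu] avg_diff[OF nu] diff_divide_distrib[symmetric] algebra_simps)
lemma step_cmult: "step (\<lambda>q. c * f q) p = c * step f p"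
  by (simp add: step_def avg_cmult[OF mu] avg_cmult[OF nu] algebra_simps)
lemma step_const: "p \<in> S_set \<Longrightarrow> step (\<lambda>q. c) p = c"
  by (simp add: step_def avg_const[OF mu] avg_const[OF nu] S_set_iff distrib_right[symmetric])
lemma step_sum: "(\<And>i. i \<in> I \<Longrightarrow> bm (f i)) \<Longrightarrow> p \<in> S_set \<Longrightarrow>
    step (\<lambda>q. \<Sum>i\<in>I. f i q) p = (\<Sum>i\<in>I. step (f i) p)"
  by (simp add: step_def avg_sum[OF mu] avg_sum[OF nu] sum_divide_distrib[symmetric]
    sum_distrib_left sum.distrib)
lemma step_mono: "bm f \<Longrightarrow> bm g \<Longrightarrow> p \<in> S_set \<Longrightarrow> (\<And>q. q \<in> S_set \<Longrightarrow> f q \<le> g q) \<Longrightarrow>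
    step f p \<le> step g p"
  unfolding step_def using avg_mono[OF mu, of "(1,0)" f g p] avg_mono[OF nu, of "(0,1)" f g p]
  by (auto simp: S_set_iff intro!: divide_right_mono add_mono mult_left_mono)
text \<open>Positivity together with the preservation of constants makes \<open>step\<close> a
  contraction for the sup norm.\<close>

lemma step_abs_le:
  assumes "bm f" "p \<in> S_set" "\<And>q. q \<in> S_set \<Longrightarrow> \<bar>f q\<bar> \<le> C"
  shows "\<bar>step f p\<bar> \<le> C"
proof -
  have "step f p \<le> step (\<lambda>_. C) p"
    using assms by (intro step_mono bm_const) (auto dest: abs_le_D1)
  moreover have "step (\<lambda>_. - C) p \<le> step f p"
  proof (intro step_mono bm_const assms)
    fix q assume "q \<in> S_set" then show "- C \<le> f q" using assms(3)[of q] by linarith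
  qed
  ultimately show ?thesis using assms(2) by (simp add: step_const abs_le_iff)
qed

lemma step_bc:
  assumes "bc f" shows "bc (step f)"
proof -
  obtain C where C: "C \<ge> 0" "\<And>p. p \<in> S_set \<Longrightarrow> \<bar>f p\<bar> \<le> C" using bmD[OF bc_imp_bm[OF assms]] by metis
  show ?thesis
  proof (rule bcI)
    show "continuous_on S_set (step f)" unfolding step_def
      using avg_continuous[OF mu _ _ assms, of "(1,0)"] avg_continuous[OF nu _ _ assms, of "(0,1)"]
      by (intro continuous_intros) (auto simp: S_set_iff)
    show "\<bar>step f p\<bar> \<le> C" if "p \<in> S_set" for p
      using that C by (intro step_abs_le bc_imp_bm assms) auto
  qed
qed

lemma step_cong: "p \<in> S_set \<Longrightarrow> (\<And>q. q \<in> S_set \<Longrightarrow> f q = g q) \<Longrightarrow> step f p = step g p"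
  unfolding step_def avg_def
  using shift_bound[OF mu, of "(1,0)" p] shift_bound[OF nu, of "(0,1)" p]
  by (simp cong: Bochner_Integration.integral_cong)

lemma prob_mu: "prob_space \<mu>" and prob_nu: "prob_space \<nu>"
  using mu nu Prob_onD(1) by auto

lemma ident_integrable: "M \<in> Prob_on 0 \<beta> \<Longrightarrow> integrable M (\<lambda>k. k)"
proof -
  assume M: "M \<in> Prob_on 0 \<beta>"
  interpret prob_space M using Prob_onD(1)[OF M] .
  have "(\<lambda>k. k) \<in> measurable (restrict_space borel {0..\<beta>}) borel"
    by (intro measurable_restrict_space1) auto
  then have "(\<lambda>k. k) \<in> measurable M borel"
    using measurable_cong_sets[OF Prob_onD(2)[OF M] refl] by auto
  then show ?thesis using Prob_onD(3)[OF M]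
    by (intro integrable_const_bound[where B=\<beta>]) auto
qed

text \<open>The total content grows by the same mean under either colour, so functions of the total
  content that lie below an affine function of the increment are controlled by the mean alone.\<close>

lemma step_le_affine:
  assumes f: "bm f" and p: "p \<in> S_set"
    and le: "\<And>k. 0 \<le> k \<Longrightarrow> k \<le> \<beta> \<Longrightarrow> f (p + k *\<^sub>R (1,0)) \<le> a + b * k"
      "\<And>k. 0 \<le> k \<Longrightarrow> k \<le> \<beta> \<Longrightarrow> f (p + k *\<^sub>R (0,1)) \<le> a + b * k"
  shows "step f p \<le> a + b * m"
proof -
  have *: "avg M e f p \<le> a + b * m" if M: "M \<in> Prob_on 0 \<beta>" and mean: "(\<integral>k. k \<partial>M) = m"
    and e: "fst e \<ge> 0" "snd e \<ge> 0"
    and le: "\<And>k. 0 \<le> k \<Longrightarrow> k \<le> \<beta> \<Longrightarrow> f (p + k *\<^sub>R e) \<le> a + b * k" for M e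
  proof -
    interpret prob_space M using Prob_onD(1)[OF M] .
    have "avg M e f p \<le> (\<integral>k. a + b * k \<partial>M)"
      unfolding avg_def using shift_integrable[OF M e f p] ident_integrable[OF M] le Prob_onD(3)[OF M]
      by (intro integral_mono) auto
    also have "\<dots> = a + b * m" using ident_integrable[OF M] mean by (simp add: prob_space)
    finally show ?thesis .
  qed
  have "step f p \<le> (fst p * (a + b * m) + snd p * (a + b * m)) / (fst p + snd p)"
    unfolding step_def using p *[OF mu mean_mu, of "(1,0)"] *[OF nu mean_nu, of "(0,1)"] le
    by (auto simp: S_set_iff intro!: divide_right_mono add_mono mult_left_mono)
  also have "\<dots> = a + b * m" using p by (simp add: S_set_iff distrib_right[symmetric])
  finally show ?thesis .
qed

section \<open>Exponential contraction and the maximum principle\<close>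

lemma m_le_beta: "m \<le> \<beta>"
proof -
  interpret prob_space \<mu> by (rule prob_mu)
  have "(\<integral>k. k \<partial>\<mu>) \<le> (\<integral>k. \<beta> \<partial>\<mu>)"
    using ident_integrable[OF mu] Prob_onD(3)[OF mu] by (intro integral_mono) auto
  then show ?thesis by (simp add: mean_mu prob_space)
qed

text \<open>Averaging the affine bound \<open>1 - k / (1 + \<beta>)\<close> for
  \<open>exp (- k)\<close> over an increment of mean \<open>m\<close> gives exactly this
  factor.\<close>

definition rho :: real where "rho = 1 - m / (1 + \<beta>)"

lemma rho: "0 \<le> rho" "rho < 1"
  using m_pos m_le_beta beta_pos by (auto simp: rho_def field_simps)

definition decay :: "real \<times> real \<Rightarrow> real" where "decay p = exp (- (fst p + snd p))"

lemma decay_bc: "bc decay"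
  unfolding decay_def by (rule bcI[of _ 1]) (auto simp: S_set_iff intro!: continuous_intros)

text \<open>The bound is affine in \<open>k\<close> so that its average depends on the law of the
  increment only through the mean.\<close>

lemma exp_minus_le:
  assumes "0 \<le> k" "k \<le> \<beta>"
  shows "exp (- k) \<le> 1 - k / (1 + \<beta>)"
proof -
  have "1 + k \<le> exp k" by (rule exp_ge_add_one_self)
  then have "exp (- k) \<le> 1 / (1 + k)" using assms by (simp add: exp_minus field_simps)
  also have "\<dots> = 1 - k / (1 + k)" using assms by (simp add: field_simps)
  also have "\<dots> \<le> 1 - k / (1 + \<beta>)" using assms by (simp add: frac_le)
  finally show ?thesis .
qed

lemma step_decay:
  assumes "p \<in> S_set" shows "step decay p \<le> rho * decay p"
proof -
  have *: "exp (- (fst p + snd p)) * exp (- k) \<le> decay p + (- decay p / (1 + \<beta>)) * k"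
    if "0 \<le> k" "k \<le> \<beta>" for k
  proof -
    have "exp (- (fst p + snd p)) * exp (- k) \<le> decay p * (1 - k / (1 + \<beta>))"
      unfolding decay_def by (intro mult_left_mono exp_minus_le that) auto
    then show ?thesis by (simp add: algebra_simps)
  qed
  have "step decay p \<le> decay p + (- decay p / (1 + \<beta>)) * m"
    using * by (intro step_le_affine bc_imp_bm decay_bc assms)
      (auto simp: decay_def exp_add[symmetric] algebra_simps)
  also have "\<dots> = rho * decay p" by (simp add: rho_def algebra_simps)
  finally show ?thesis .
qed

text \<open>The barrier \<open>c + e + A * decay\<close> dominates \<open>D\<close> at the start: by
  the hypothesis at infinity where the total is large, by the size of \<open>A\<close> elsewhere.
  Each application of \<open>step\<close> preserves the domination and multiplies the excess by
  \<open>rho\<close>, so the excess dies out at every fixed point.\<close>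

lemma max_principle:
  assumes D: "bc D" and sub: "\<And>p. p \<in> S_set \<Longrightarrow> D p \<le> step D p"
    and inf: "\<And>e. e > 0 \<Longrightarrow> \<exists>R. \<forall>p\<in>S_set. fst p + snd p \<ge> R \<longrightarrow> D p \<le> c + e"
    and p: "p \<in> S_set"
  shows "D p \<le> c"
proof (rule field_le_epsilon)
  fix e :: real assume "e > 0"
  then obtain R where R: "\<And>p. p \<in> S_set \<Longrightarrow> fst p + snd p \<ge> R \<Longrightarrow> D p \<le> c + e"
    using inf by blast
  obtain C where C: "C \<ge> 0" "\<And>p. p \<in> S_set \<Longrightarrow> \<bar>D p\<bar> \<le> C"
    using bmD[OF bc_imp_bm[OF D]] by metis
  \<comment> \<open>\<open>N\<close> bounds \<open>D - (c + e)\<close> everywhere, and the factor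
    \<open>exp R\<close> in \<open>A\<close> makes \<open>A * decay q\<close> at least
    \<open>N\<close> wherever the total of \<open>q\<close> is below \<open>R\<close>.\<close>
  define N where "N = C + \<bar>c + e\<bar>"
  define A where "A = N * exp R"
  have A: "A \<ge> 0" using C by (simp add: A_def N_def)
  have bd: "D q \<le> c + e + A * rho ^ n * decay q" if "q \<in> S_set" for q n
    using that
  proof (induction n arbitrary: q)
    case 0
    show ?case
    proof (cases "fst q + snd q \<ge> R")
      case True
      then show ?thesis using R[OF 0 True] A by (simp add: decay_def add_increasing2)
    next
      case False
      have "D q \<le> c + e + N * 1" using C(2)[OF 0] by (simp add: N_def)
      also have "N * 1 \<le> N * (exp R * decay q)"
        using False C by (intro mult_left_mono) (auto simp: decay_def N_def exp_add[symmetric])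
      finally show ?thesis by (simp add: A_def mult.assoc)
    qed
  next
    case (Suc n)
    have b: "bm (\<lambda>q. A * rho ^ n * decay q)" by (intro bm_cmult bc_imp_bm decay_bc)
    have "D q \<le> step D q" by (rule sub) fact
    also have "\<dots> \<le> step (\<lambda>q. (c + e) + A * rho ^ n * decay q) q"
      using Suc by (intro step_mono bm_add bm_const b bc_imp_bm[OF D]) auto
    also have "\<dots> = (c + e) + A * rho ^ n * step decay q"
      using Suc.prems by (subst step_add[OF bm_const b]) (auto simp: step_const step_cmult)
    also have "\<dots> \<le> (c + e) + A * rho ^ n * (rho * decay q)"
      using A rho step_decay[OF Suc.prems] by (intro add_left_mono mult_left_mono) auto
    finally show ?case by (simp add: mult_ac)
  qed
  have "(\<lambda>n. rho ^ n) \<longlonglongrightarrow> 0" by (rule LIMSEQ_power_zero) (use rho in simp)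
  then have "(\<lambda>n. c + e + A * rho ^ n * decay p) \<longlonglongrightarrow> c + e + A * 0 * decay p"
    by (intro tendsto_mult tendsto_add tendsto_const)
  then have "(\<lambda>n. c + e + A * rho ^ n * decay p) \<longlonglongrightarrow> c + e"
    by simp
  then show "D p \<le> c + e"
    by (rule LIMSEQ_le_const) (use bd[OF p] in auto)
qed

end

section \<open>Harmonic functions with polynomial boundary values\<close>

definition proportion :: "real \<times> real \<Rightarrow> real" where
  "proportion p = fst p / (fst p + snd p)"

lemma proportion_range: "p \<in> S_set \<Longrightarrow> proportion p \<in> {0..1}"
  by (auto simp: S_set_iff proportion_def field_simps)

lemma bc_proportion:
  assumes "continuous_on {0..1} f"
  shows "bc (\<lambda>p. f (proportion p))"
proof -
  have "bounded (f ` {0..1})"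
    by (intro compact_imp_bounded compact_continuous_image assms) auto
  then obtain C where C: "\<And>z. z \<in> {0..1} \<Longrightarrow> \<bar>f z\<bar> \<le> C" by (auto simp: bounded_iff simp del: atLeastAtMost_iff)
  have "continuous_on S_set proportion"
    unfolding proportion_def by (intro continuous_intros) (auto simp: S_set_iff)
  then have "continuous_on S_set (\<lambda>p. f (proportion p))"
    by (rule continuous_on_compose2[OF assms]) (use proportion_range in blast)
  then show ?thesis
    by (rule bcI[of _ C]) (use C proportion_range in blast)
qed

context urn
begin

text \<open>An approximation affine in the increment averages to a term in the mean alone. The
  first-order terms of the two colours can therefore cancel although their laws differ.\<close>

lemma avg_abs_affine:
  assumes M: "M \<in> Prob_on 0 \<beta>" and mean: "(\<integral>k. k \<partial>M) = m"
    and e: "fst e \<ge> 0" "snd e \<ge> 0" and f: "bm f" and p: "p \<in> S_set"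
    and le: "\<And>k. 0 \<le> k \<Longrightarrow> k \<le> \<beta> \<Longrightarrow> \<bar>f (p + k *\<^sub>R e) - (a + b * k)\<bar> \<le> c"
  shows "\<bar>avg M e f p - (a + b * m)\<bar> \<le> c"
proof -
  interpret prob_space M using Prob_onD(1)[OF M] .
  note int = shift_integrable[OF M e f p] ident_integrable[OF M]
  have "avg M e f p - (a + b * m) = (\<integral>k. f (p + k *\<^sub>R e) - (a + b * k) \<partial>M)"
    using int by (simp add: avg_def mean prob_space)
  also have "\<bar>\<dots>\<bar> \<le> (\<integral>k. \<bar>f (p + k *\<^sub>R e) - (a + b * k)\<bar> \<partial>M)"
    by (rule integral_abs_bound)
  also have "\<dots> \<le> (\<integral>k. c \<partial>M)"
    using int le Prob_onD(3)[OF M] by (intro integral_mono) auto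
  finally show ?thesis by (simp add: prob_space)
qed

text \<open>The summand \<open>1\<close> keeps the function bounded near the origin, which the bare
  reciprocal of the total is not.\<close>

definition inv_total :: "real \<times> real \<Rightarrow> real" where "inv_total p = 1 / (1 + (fst p + snd p))"

lemma inv_total_bc: "bc inv_total"
  unfolding inv_total_def
proof (rule bcI[of _ 1])
  show "continuous_on S_set (\<lambda>p::real\<times>real. 1 / (1 + (fst p + snd p)))"
    by (intro continuous_intros) (auto simp: S_set_iff)
  show "\<bar>1 / (1 + (fst p + snd p))\<bar> \<le> 1" if "p \<in> S_set" for p
    using that by (simp add: S_set_iff)
qed

text \<open>The expected decrease of \<open>inv_total\<close> is of order \<open>(x+y)^-2\<close>
  for large totals, the same order as the error in \<open>step_proportion_small\<close>; this is
  what lets one absorb the other.\<close>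

lemma step_inv_total:
  assumes p: "p \<in> S_set"
  shows "m / ((1 + (fst p + snd p)) * (1 + (fst p + snd p) + \<beta>)) \<le> inv_total p - step inv_total p"
proof -
  define s where "s = fst p + snd p"
  have s: "s > 0" using p by (simp add: S_set_iff s_def)
  have *: "1 / (1 + (s + k)) \<le> 1 / (1 + s) + - (1 / ((1 + s) * (1 + s + \<beta>))) * k"
    if "0 \<le> k" "k \<le> \<beta>" for k
  proof -
    have "1 / (1 + s) - 1 / (1 + (s + k)) = k / ((1 + s) * (1 + s + k))"
      using s that by (simp add: field_simps)
    also have "\<dots> \<ge> k / ((1 + s) * (1 + s + \<beta>))"
      using s that by (intro divide_left_mono mult_left_mono) auto
    finally show ?thesis by simp
  qed
  have "step inv_total p \<le> 1 / (1 + s) + - (1 / ((1 + s) * (1 + s + \<beta>))) * m"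
    using * by (intro step_le_affine bc_imp_bm inv_total_bc p)
      (auto simp: inv_total_def s_def algebra_simps)
  then show ?thesis by (simp add: inv_total_def s_def)
qed

text \<open>With total \<open>s\<close>, a draw moves the proportion by
  \<open>y * k / (s * (s + k))\<close> or by \<open>- x * k / (s * (s + k))\<close>. Replacing
  \<open>s + k\<close> by \<open>s\<close> makes this linear in \<open>k\<close> at second-order
  cost; the linear parts, weighted by \<open>x / s\<close> and \<open>y / s\<close>, cancel because
  the means agree. The Taylor remainder is quadratic in a displacement of at most
  \<open>\<beta> / s\<close>.\<close>

lemma step_proportion_small:
  assumes f: "continuous_on {0..1} f"
    and taylor: "\<And>a b. a \<in> {0..1} \<Longrightarrow> b \<in> {0..1} \<Longrightarrow> \<bar>f b - f a - f' a * (b - a)\<bar> \<le> C2 * (b - a)\<^sup>2"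
    and f': "\<And>a. a \<in> {0..1} \<Longrightarrow> \<bar>f' a\<bar> \<le> C1"
    and C: "C1 \<ge> 0" "C2 \<ge> 0"
    and p: "p \<in> S_set"
  shows "\<bar>step (\<lambda>q. f (proportion q)) p - f (proportion p)\<bar> \<le> (C1 + C2) * \<beta>\<^sup>2 / (fst p + snd p)\<^sup>2"
proof -
  define x y s z where "x = fst p" and "y = snd p" and "s = x + y" and "z = x / s"
  have xy: "x \<ge> 0" "y \<ge> 0" "s > 0" "x \<le> s" "y \<le> s"
    using p by (auto simp: S_set_iff x_def y_def s_def)
  have z: "z \<in> {0..1}" using proportion_range[OF p] by (simp add: z_def s_def x_def y_def proportion_def)
  define E where "E = (C1 + C2) * \<beta>\<^sup>2 / s\<^sup>2"
  let ?P = "\<lambda>q. f (proportion q)"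
  \<comment> \<open>Here \<open>c\<close> stands for \<open>y\<close> in a draw of the first colour
    and for \<open>- x\<close> in a draw of the second.\<close>
  have key: "\<bar>f w - (f z + f' z * (c / s\<^sup>2) * k)\<bar> \<le> E"
    if k: "0 \<le> k" "k \<le> \<beta>" and w: "w \<in> {0..1}" and wz: "w - z = c * k / (s * (s + k))" and c: "\<bar>c\<bar> \<le> s"
    for w k c
  proof -
    have "\<bar>w - z\<bar> = \<bar>c\<bar> * k / (s * (s + k))"
      using xy k by (simp add: wz abs_mult)
    also have "\<dots> \<le> s * \<beta> / (s * s)"
      using xy k c by (intro frac_le mult_mono) auto
    also have "\<dots> = \<beta> / s" using xy by simp
    finally have "\<bar>w - z\<bar>\<^sup>2 \<le> (\<beta> / s)\<^sup>2" by (intro power_mono) auto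
    then have "C2 * (w - z)\<^sup>2 \<le> C2 * (\<beta>\<^sup>2 / s\<^sup>2)"
      using C by (intro mult_left_mono) (auto simp: power_divide)
    then have 1: "\<bar>f w - f z - f' z * (w - z)\<bar> \<le> C2 * (\<beta>\<^sup>2 / s\<^sup>2)"
      using taylor[OF z w] by linarith
    \<comment> \<open>The exact cost of linearising the displacement, that is, of replacing
      \<open>s + k\<close> by \<open>s\<close> in its denominator.\<close>
    have "(w - z) - c / s\<^sup>2 * k = - (c * k\<^sup>2 / (s\<^sup>2 * (s + k)))"
      unfolding wz using xy k by (simp add: divide_simps) (simp add: power2_eq_square algebra_simps)
    then have "\<bar>(w - z) - c / s\<^sup>2 * k\<bar> = \<bar>c\<bar> * k\<^sup>2 / (s\<^sup>2 * (s + k))"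
      using xy k by (simp add: abs_mult)
    also have "\<dots> \<le> s * \<beta>\<^sup>2 / (s\<^sup>2 * s)"
      using xy k c by (intro frac_le mult_mono power_mono) auto
    also have "\<dots> = \<beta>\<^sup>2 / s\<^sup>2" using xy by simp
    finally have "\<bar>f' z * ((w - z) - c / s\<^sup>2 * k)\<bar> \<le> C1 * (\<beta>\<^sup>2 / s\<^sup>2)"
      unfolding abs_mult using f'[OF z] C by (intro mult_mono) auto
    moreover have "f w - (f z + f' z * (c / s\<^sup>2) * k) =
        (f w - f z - f' z * (w - z)) + f' z * ((w - z) - c / s\<^sup>2 * k)"
      by (simp add: algebra_simps)
    moreover have "E = C1 * (\<beta>\<^sup>2 / s\<^sup>2) + C2 * (\<beta>\<^sup>2 / s\<^sup>2)"
      by (simp add: E_def add_divide_distrib algebra_simps)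
    ultimately show ?thesis using 1 by linarith
  qed
  have bmP: "bm ?P" by (intro bc_imp_bm bc_proportion f)
  have mu': "\<bar>avg \<mu> (1, 0) ?P p - (f z + f' z * (y / s\<^sup>2) * m)\<bar> \<le> E"
  proof (rule avg_abs_affine[OF mu mean_mu _ _ bmP p])
    fix k assume k: "0 \<le> k" "k \<le> \<beta>"
    have w: "proportion (p + k *\<^sub>R (1, 0)) \<in> {0..1}"
      using shift_in_S_set[OF p k(1), of "(1,0)"] by (intro proportion_range) auto
    have "proportion (p + k *\<^sub>R (1, 0)) - z = y * k / (s * (s + k))"
      using xy k by (simp add: proportion_def x_def[symmetric] y_def[symmetric] z_def divide_simps)
        (simp add: s_def algebra_simps)
    then show "\<bar>f (proportion (p + k *\<^sub>R (1, 0))) - (f z + f' z * (y / s\<^sup>2) * k)\<bar> \<le> E"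
      using xy by (intro key k w) auto
  qed auto
  have nu': "\<bar>avg \<nu> (0, 1) ?P p - (f z + f' z * (- x / s\<^sup>2) * m)\<bar> \<le> E"
  proof (rule avg_abs_affine[OF nu mean_nu _ _ bmP p])
    fix k assume k: "0 \<le> k" "k \<le> \<beta>"
    have w: "proportion (p + k *\<^sub>R (0, 1)) \<in> {0..1}"
      using shift_in_S_set[OF p k(1), of "(0,1)"] by (intro proportion_range) auto
    have "proportion (p + k *\<^sub>R (0, 1)) - z = - x * k / (s * (s + k))"
      using xy k by (simp add: proportion_def x_def[symmetric] y_def[symmetric] z_def divide_simps)
        (simp add: s_def algebra_simps)
    then show "\<bar>f (proportion (p + k *\<^sub>R (0, 1))) - (f z + f' z * (- x / s\<^sup>2) * k)\<bar> \<le> E"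
      using xy by (intro key k w) auto
  qed auto
  define A B where "A = avg \<mu> (1, 0) ?P p - (f z + f' z * (y / s\<^sup>2) * m)"
    and "B = avg \<nu> (0, 1) ?P p - (f z + f' z * (- x / s\<^sup>2) * m)"
  \<comment> \<open>The contributions \<open>x * y * m\<close> and \<open>- y * x * m\<close> of the
    derivative terms cancel here, and only the two averaging errors remain.\<close>
  have "step ?P p - f z = (x * A + y * B) / s"
    using xy unfolding step_def A_def B_def x_def[symmetric] y_def[symmetric] s_def[symmetric]
    by (simp add: field_simps) (simp add: s_def algebra_simps)
  also have "\<bar>\<dots>\<bar> \<le> (x * E + y * E) / s"
  proof -
    have "\<bar>x * A + y * B\<bar> \<le> x * \<bar>A\<bar> + y * \<bar>B\<bar>"
      using abs_triangle_ineq[of "x * A" "y * B"] xy by (simp add: abs_mult)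
    also have "\<dots> \<le> x * E + y * E"
      using mu' nu' xy by (intro add_mono mult_left_mono) (auto simp: A_def B_def)
    finally show ?thesis using xy by (simp add: divide_right_mono)
  qed
  also have "\<dots> = E" using xy by (simp add: s_def distrib_right[symmetric])
  finally show ?thesis by (simp add: E_def z_def s_def x_def y_def proportion_def)
qed

text \<open>The estimate by \<open>s^-2\<close> is useless near the origin, so for totals up to 1
  the sup bound of \<open>f\<close> replaces it. A bound by a one-step decrease of
  \<open>inv_total\<close> is the form that telescopes under iteration.\<close>

lemma step_error:
  assumes f: "continuous_on {0..1} f"
    and taylor: "\<And>a b. a \<in> {0..1} \<Longrightarrow> b \<in> {0..1} \<Longrightarrow> \<bar>f b - f a - f' a * (b - a)\<bar> \<le> C2 * (b - a)\<^sup>2"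
    and f': "\<And>a. a \<in> {0..1} \<Longrightarrow> \<bar>f' a\<bar> \<le> C1"
    and C: "C1 \<ge> 0" "C2 \<ge> 0"
  obtains K where "K \<ge> 0" "\<And>p. p \<in> S_set \<Longrightarrow>
    \<bar>step (\<lambda>q. f (proportion q)) p - f (proportion p)\<bar> \<le> K * (inv_total p - step inv_total p)"
proof -
  let ?P = "\<lambda>q. f (proportion q)"
  have bmP: "bm ?P" by (intro bc_imp_bm bc_proportion f)
  obtain C0 where C0: "C0 \<ge> 0" "\<And>p. p \<in> S_set \<Longrightarrow> \<bar>?P p\<bar> \<le> C0" using bmD[OF bmP] by metis
  \<comment> \<open>\<open>D\<close> serves both regimes: the error is at most \<open>D\<close> when
    the total is at most 1, and at most \<open>D / s\<^sup>2\<close> beyond.\<close>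
  define D where "D = 2 * C0 + (C1 + C2) * \<beta>\<^sup>2"
  \<comment> \<open>The factor \<open>2 * (2 + \<beta>)\<close> bounds
    \<open>(1 + s) * (1 + s + \<beta>)\<close> for \<open>s \<le> 1\<close>, and does so after
    multiplication by \<open>s\<^sup>2\<close> for \<open>s > 1\<close>; the division by
    \<open>m\<close> cancels the numerator in \<open>step_inv_total\<close>.\<close>
  define K where "K = 2 * (2 + \<beta>) * D / m"
  have D: "D \<ge> 0" using C0 C by (simp add: D_def)
  show thesis
  proof (rule that)
    show K: "K \<ge> 0" using D m_pos beta_pos by (simp add: K_def)
    fix p assume p: "p \<in> S_set"
    define s where "s = fst p + snd p"
    define X where "X = \<bar>step ?P p - ?P p\<bar>"
    have s: "s > 0" using p by (simp add: S_set_iff s_def)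
    have "X * ((1 + s) * (1 + s + \<beta>)) \<le> 2 * (2 + \<beta>) * D"
    proof (cases "s \<le> 1")
      case True
      have "\<bar>step ?P p\<bar> \<le> C0" using C0 by (intro step_abs_le bmP p) auto
      then have "X \<le> 2 * C0" using C0(2)[OF p] by (simp add: X_def)
      then have XD: "X \<le> D" using C by (simp add: D_def add_increasing2)
      have le: "(1 + s) * (1 + s + \<beta>) \<le> 2 * (2 + \<beta>)"
        using True s beta_pos by (intro mult_mono) auto
      then have "X * ((1 + s) * (1 + s + \<beta>)) \<le> D * (2 * (2 + \<beta>))"
        using D s beta_pos by (intro mult_mono XD le) auto
      then show ?thesis by (simp add: mult_ac)
    next
      case False
      have "X \<le> (C1 + C2) * \<beta>\<^sup>2 / s\<^sup>2"
        unfolding X_def s_def by (rule step_proportion_small[OF f taylor f' C p])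
      also have "\<dots> \<le> D / s\<^sup>2" using C0 by (intro divide_right_mono) (auto simp: D_def)
      finally have XD: "X \<le> D / s\<^sup>2" .
      have b: "\<beta> \<le> \<beta> * s" using False beta_pos by simp
      have "1 + s + \<beta> \<le> (2 + \<beta>) * s" using False b unfolding distrib_right by linarith
      then have le: "(1 + s) * (1 + s + \<beta>) \<le> (2 * s) * ((2 + \<beta>) * s)"
        using False s beta_pos by (intro mult_mono) auto
      then have "X * ((1 + s) * (1 + s + \<beta>)) \<le> D / s\<^sup>2 * ((2 * s) * ((2 + \<beta>) * s))"
        using D s beta_pos by (intro mult_mono XD le) auto
      also have "\<dots> = 2 * (2 + \<beta>) * D" using s by (simp add: power2_eq_square)
      finally show ?thesis .
    qed
    then have "X \<le> 2 * (2 + \<beta>) * D / ((1 + s) * (1 + s + \<beta>))"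
      using s beta_pos by (simp add: pos_le_divide_eq)
    also have "\<dots> = K * (m / ((1 + s) * (1 + s + \<beta>)))"
      using m_pos by (simp add: K_def)
    also have "\<dots> \<le> K * (inv_total p - step inv_total p)"
      unfolding s_def by (intro mult_left_mono step_inv_total p K)
    finally show "\<bar>step ?P p - ?P p\<bar> \<le> K * (inv_total p - step inv_total p)" by (simp add: X_def)
  qed
qed

section \<open>Iterates of the step operator and their uniform limit\<close>

lemma steps_bc: "bc f \<Longrightarrow> bc ((step ^^ n) f)"
  by (induction n) (auto intro: step_bc)

text \<open>The barrier of the maximum principle again: \<open>inv_total\<close> is at most
  \<open>1 / (1 + R)\<close> where the total exceeds \<open>R\<close>, and at most 1, hence at most
  \<open>exp R * decay p\<close>, elsewhere.\<close>

lemma steps_inv_total_bounds: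
  assumes p: "p \<in> S_set" and R: "R \<ge> 0"
  shows "0 \<le> (step ^^ n) inv_total p" "(step ^^ n) inv_total p \<le> 1 / (1 + R) + exp R * rho ^ n * decay p"
proof -
  have "0 \<le> (step ^^ n) inv_total p \<and> (step ^^ n) inv_total p \<le> 1 / (1 + R) + exp R * rho ^ n * decay p"
    using p
  proof (induction n arbitrary: p)
    case 0
    show ?case
    proof (cases "fst p + snd p \<ge> R")
      case True
      then have "inv_total p \<le> 1 / (1 + R)"
        unfolding inv_total_def using R by (intro divide_left_mono) auto
      moreover have "0 \<le> exp R * rho ^ 0 * decay p" by (simp add: decay_def)
      moreover have "0 \<le> inv_total p" using 0 by (simp add: inv_total_def S_set_iff)
      ultimately show ?thesis by simp
    next
      case False
      then have "1 \<le> exp R * decay p" by (simp add: decay_def exp_add[symmetric])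
      moreover have "inv_total p \<le> 1" "0 \<le> inv_total p" using 0 by (auto simp: inv_total_def S_set_iff)
      moreover have "0 \<le> 1 / (1 + R)" using R by simp
      ultimately have "inv_total p \<le> 1 / (1 + R) + exp R * decay p" "0 \<le> inv_total p" by linarith+
      then show ?thesis by simp
    qed
  next
    case (Suc n)
    have b: "bm (\<lambda>q. exp R * rho ^ n * decay q)" by (intro bm_cmult bc_imp_bm decay_bc)
    have i: "bm ((step ^^ n) inv_total)" by (intro bc_imp_bm steps_bc inv_total_bc)
    have "step (\<lambda>_. 0) p \<le> step ((step ^^ n) inv_total) p"
      using Suc by (intro step_mono bm_const i) auto
    moreover have "step ((step ^^ n) inv_total) p \<le> step (\<lambda>q. 1 / (1 + R) + exp R * rho ^ n * decay q) p"
      using Suc by (intro step_mono bm_add bm_const b i) auto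
    moreover have "step (\<lambda>q. 1 / (1 + R) + exp R * rho ^ n * decay q) p
        = 1 / (1 + R) + exp R * rho ^ n * step decay p"
      using Suc.prems by (subst step_add[OF bm_const b]) (auto simp: step_const step_cmult)
    moreover have "\<dots> \<le> 1 / (1 + R) + exp R * rho ^ n * (rho * decay p)"
      using rho step_decay[OF Suc.prems] by (intro add_left_mono mult_left_mono) auto
    ultimately have "0 \<le> step ((step ^^ n) inv_total) p"
        "step ((step ^^ n) inv_total) p \<le> 1 / (1 + R) + exp R * rho ^ n * (rho * decay p)"
      using step_const[OF Suc.prems, of 0] by linarith+
    then show ?case by (simp add: mult_ac)
  qed
  then show "0 \<le> (step ^^ n) inv_total p" "(step ^^ n) inv_total p \<le> 1 / (1 + R) + exp R * rho ^ n * decay p"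
    by auto
qed

lemma steps_inv_total_null:
  assumes "e > 0"
  obtains N where "\<And>n p. n \<ge> N \<Longrightarrow> p \<in> S_set \<Longrightarrow> (step ^^ n) inv_total p \<le> e"
proof -
  \<comment> \<open>\<open>R\<close> is fixed first, to make \<open>1 / (1 + R)\<close> at most
    \<open>e / 2\<close>; only then is the exponent of \<open>rho\<close> taken large. As
    \<open>decay\<close> is at most 1, the resulting index is independent of the point.\<close>
  define R where "R = 2 / e"
  have R: "R > 0" "1 / (1 + R) \<le> e / 2"
    using assms by (auto simp: R_def field_simps add_pos_pos)
  have "(\<lambda>n. exp R * rho ^ n) \<longlonglongrightarrow> exp R * 0"
    using rho by (intro tendsto_mult tendsto_const LIMSEQ_power_zero) auto
  then have "\<forall>\<^sub>F n in sequentially. exp R * rho ^ n < e / 2"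
    using assms by (intro order_tendstoD(2)[of _ 0]) auto
  then obtain N where N: "\<And>n. n \<ge> N \<Longrightarrow> exp R * rho ^ n < e / 2"
    by (auto simp: eventually_sequentially)
  show thesis
  proof (rule that)
    fix n p assume n: "n \<ge> N" and p: "p \<in> S_set"
    have "(step ^^ n) inv_total p \<le> 1 / (1 + R) + exp R * rho ^ n * decay p"
      using R by (intro steps_inv_total_bounds p) auto
    also have "\<dots> \<le> e / 2 + exp R * rho ^ n * 1"
      using R rho p by (intro add_mono mult_left_mono) (auto simp: decay_def S_set_iff)
    also have "\<dots> \<le> e" using N[OF n] by simp
    finally show "(step ^^ n) inv_total p \<le> e" .
  qed
qed

text \<open>The sup-norm contraction property lets \<open>step\<close> pass to uniform
  limits.\<close>

lemma uniform_limit_step: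
  assumes a: "\<And>n. bc (a n)" and lim: "uniform_limit S_set a h sequentially"
  shows "bc h" "p \<in> S_set \<Longrightarrow> (\<lambda>n. step (a n) p) \<longlonglongrightarrow> step h p"
proof -
  have cont: "continuous_on S_set h"
    using a by (intro uniform_limit_theorem[OF _ lim]) (auto simp: bc_def)
  obtain N where N: "\<And>n p. n \<ge> N \<Longrightarrow> p \<in> S_set \<Longrightarrow> dist (a n p) (h p) < 1"
    using uniform_limitD[OF lim zero_less_one] by (auto simp: eventually_sequentially)
  obtain C where C: "\<And>p. p \<in> S_set \<Longrightarrow> \<bar>a N p\<bar> \<le> C" using bmD[OF bc_imp_bm[OF a]] by metis
  show bc: "bc h"
  proof (rule bcI[OF cont])
    fix p assume "p \<in> S_set"
    then show "\<bar>h p\<bar> \<le> C + 1" using N[of N p] C[of p] by (auto simp: dist_real_def)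
  qed
  assume p: "p \<in> S_set"
  show "(\<lambda>n. step (a n) p) \<longlonglongrightarrow> step h p"
  proof (rule LIMSEQ_I)
    fix r :: real assume "r > 0"
    then obtain N where N: "\<And>n p. n \<ge> N \<Longrightarrow> p \<in> S_set \<Longrightarrow> dist (a n p) (h p) < r / 2"
      using uniform_limitD[OF lim, of "r/2"] by (auto simp: eventually_sequentially)
    have "norm (step (a n) p - step h p) < r" if "n \<ge> N" for n
    proof -
      have "\<bar>step (\<lambda>q. a n q - h q) p\<bar> \<le> r / 2"
        using N[OF that] by (intro step_abs_le bm_diff bc_imp_bm a bc p) (auto simp: dist_real_def less_imp_le)
      then show ?thesis
        using \<open>r > 0\<close> by (simp add: step_diff[OF bc_imp_bm[OF a] bc_imp_bm[OF bc] p])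
    qed
    then show "\<exists>no. \<forall>n\<ge>no. norm (step (a n) p - step h p) < r" by blast
  qed
qed

text \<open>The increments of the iterates \<open>a n\<close> are dominated by those of
  \<open>v n\<close>, which telescope; so \<open>a (n + j)\<close> differs from \<open>a n\<close>
  by at most \<open>K * v n\<close>, and \<open>v n\<close> tends to 0 uniformly. Starting the
  comparison at \<open>n = 0\<close> gives the boundary behaviour at infinity.\<close>

lemma harmonic_exists:
  assumes f: "continuous_on {0..1} f"
    and taylor: "\<And>a b. a \<in> {0..1} \<Longrightarrow> b \<in> {0..1} \<Longrightarrow> \<bar>f b - f a - f' a * (b - a)\<bar> \<le> C2 * (b - a)\<^sup>2"
    and f': "\<And>a. a \<in> {0..1} \<Longrightarrow> \<bar>f' a\<bar> \<le> C1"
    and C: "C1 \<ge> 0" "C2 \<ge> 0"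
  shows "\<exists>h K. bc h \<and> K \<ge> 0 \<and> (\<forall>p\<in>S_set. step h p = h p)
    \<and> (\<forall>p\<in>S_set. \<bar>h p - f (proportion p)\<bar> \<le> K * inv_total p)
    \<and> (\<forall>y>0. h (0, y) = f 0) \<and> (\<forall>x>0. h (x, 0) = f 1)"
proof -
  let ?P = "\<lambda>q. f (proportion q)"
  obtain K where K: "K \<ge> 0" and err: "\<And>p. p \<in> S_set \<Longrightarrow>
      \<bar>step ?P p - ?P p\<bar> \<le> K * (inv_total p - step inv_total p)"
    using step_error[OF f taylor f' C] by metis
  define a where "a n = (step ^^ n) ?P" for n
  define v where "v n = (step ^^ n) inv_total" for n
  have a: "bc (a n)" for n unfolding a_def by (intro steps_bc bc_proportion f)
  have v: "bc (v n)" for n unfolding v_def by (intro steps_bc inv_total_bc)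
  note am = bc_imp_bm[OF a] and vm = bc_imp_bm[OF v]
  have v0: "0 \<le> v n p" if "p \<in> S_set" for n p
    unfolding v_def by (rule steps_inv_total_bounds(1)[OF that order_refl])
  \<comment> \<open>The one-step error bound is transported by the positive operator
    \<open>step\<close>, applied both to the difference and to its negative.\<close>
  have diff1: "\<bar>a (Suc n) p - a n p\<bar> \<le> K * (v n p - v (Suc n) p)" if "p \<in> S_set" for n p
    using that
  proof (induction n arbitrary: p)
    case 0 then show ?case using err by (simp add: a_def v_def)
  next
    case (Suc n)
    have s: "step (\<lambda>q. K * (v n q - v (Suc n) q)) p = K * (v (Suc n) p - v (Suc (Suc n)) p)"
      using step_diff[OF vm vm Suc.prems, of n "Suc n"] by (simp add: step_cmult v_def)
    have d: "step (\<lambda>q. a (Suc n) q - a n q) p = a (Suc (Suc n)) p - a (Suc n) p"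
      using step_diff[OF am am Suc.prems, of "Suc n" n] by (simp add: a_def)
    have "step (\<lambda>q. a (Suc n) q - a n q) p \<le> step (\<lambda>q. K * (v n q - v (Suc n) q)) p"
      using Suc.IH by (intro step_mono bm_diff bm_cmult am vm Suc.prems) (auto dest: abs_le_D1)
    moreover have "step (\<lambda>q. (-1) * (a (Suc n) q - a n q)) p \<le> step (\<lambda>q. K * (v n q - v (Suc n) q)) p"
      using Suc.IH by (intro step_mono bm_diff bm_cmult am vm Suc.prems) (simp add: abs_le_iff)
    ultimately show ?case
      unfolding step_cmult[of "-1"] s d by (intro abs_leI) auto
  qed
  have diff: "\<bar>a (n + j) p - a n p\<bar> \<le> K * (v n p - v (n + j) p)" if "p \<in> S_set" for n j p
  proof (induction j)
    case (Suc j)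
    have "K * (v n p - v (n + Suc j) p) = K * (v n p - v (n + j) p) + K * (v (n + j) p - v (Suc (n + j)) p)"
      by (simp add: algebra_simps)
    then show ?case using Suc diff1[OF that, of "n + j"] by (simp only: add_Suc_right)
  qed simp
  have diffv: "\<bar>a (n + j) p - a n p\<bar> \<le> K * v n p" if "p \<in> S_set" for n j p
    using diff[OF that, of n j] v0[OF that, of "n + j"] K
    by (smt (verit) mult_left_mono)
  have "uniformly_Cauchy_on S_set a"
  proof (rule uniformly_Cauchy_onI')
    fix e :: real assume e: "e > 0"
    then have "e / (K + 1) / 2 > 0" using K by simp
    then obtain N where N: "\<And>n p. n \<ge> N \<Longrightarrow> p \<in> S_set \<Longrightarrow> v n p \<le> e / (K + 1) / 2"
      unfolding v_def using steps_inv_total_null by metis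
    have "dist (a n p) (a n' p) < e" if "p \<in> S_set" "n \<ge> N" "n' > n" for p n n'
    proof -
      have "dist (a n p) (a n' p) \<le> K * v n p"
        using diffv[OF that(1), of n "n' - n"] that by (simp add: dist_real_def abs_minus_commute)
      also have "\<dots> \<le> (K + 1) * (e / (K + 1) / 2)"
        using N[of n p] that K v0 by (intro mult_mono) auto
      also have "\<dots> = e / 2"
      proof -
        have "K + 1 \<noteq> 0" using K by simp
        then show ?thesis by (simp add: field_simps)
      qed
      also have "\<dots> < e" using e by simp
      finally show ?thesis .
    qed
    then show "\<exists>M. \<forall>x\<in>S_set. \<forall>m\<ge>M. \<forall>n>m. dist (a m x) (a n x) < e" by blast
  qed
  then obtain h where h: "uniform_limit S_set a h sequentially"
    using uniformly_convergent_on_def Cauchy_uniformly_convergent by metis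
  have lim: "(\<lambda>n. a n p) \<longlonglongrightarrow> h p" if "p \<in> S_set" for p
    by (rule tendsto_uniform_limitI[OF h that])
  have 1: "step h p = h p" if "p \<in> S_set" for p
  proof (rule LIMSEQ_unique)
    show "(\<lambda>n. step (a n) p) \<longlonglongrightarrow> step h p" by (rule uniform_limit_step(2)[OF a h that])
    show "(\<lambda>n. step (a n) p) \<longlonglongrightarrow> h p" using LIMSEQ_Suc[OF lim[OF that]] by (simp add: a_def)
  qed
  have 2: "\<bar>h p - ?P p\<bar> \<le> K * inv_total p" if "p \<in> S_set" for p
  proof (rule LIMSEQ_le_const2)
    show "(\<lambda>n. \<bar>a n p - ?P p\<bar>) \<longlonglongrightarrow> \<bar>h p - ?P p\<bar>" by (intro tendsto_intros lim that)
    show "\<exists>N. \<forall>n\<ge>N. \<bar>a n p - ?P p\<bar> \<le> K * inv_total p"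
      using diffv[OF that, of 0] by (simp add: a_def v_def)
  qed
  interpret mu: prob_space \<mu> by (rule prob_mu)
  interpret nu: prob_space \<nu> by (rule prob_nu)
  \<comment> \<open>From a point of an edge the urn never leaves that edge, because the other colour
    has weight zero; the proportion is constant there.\<close>
  have a0: "a n (0, y) = f 0" if "y > 0" for n y
    using that
  proof (induction n arbitrary: y)
    case 0 then show ?case by (simp add: a_def proportion_def)
  next
    case (Suc n)
    have "avg \<nu> (0, 1) (a n) (0, y) = (\<integral>k. f 0 \<partial>\<nu>)"
      unfolding avg_def using Suc Prob_onD(3)[OF nu]
      by (intro Bochner_Integration.integral_cong) auto
    then show ?case using Suc.prems by (simp add: a_def step_def nu.prob_space)
  qed
  have a1: "a n (x, 0) = f 1" if "x > 0" for n x
    using that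
  proof (induction n arbitrary: x)
    case 0 then show ?case by (simp add: a_def proportion_def)
  next
    case (Suc n)
    have "avg \<mu> (1, 0) (a n) (x, 0) = (\<integral>k. f 1 \<partial>\<mu>)"
      unfolding avg_def using Suc Prob_onD(3)[OF mu]
      by (intro Bochner_Integration.integral_cong) auto
    then show ?case using Suc.prems by (simp add: a_def step_def mu.prob_space)
  qed
  have 3: "h (0, y) = f 0" if "y > 0" for y
    using lim[of "(0, y)"] a0[OF that] that by (simp add: S_set_iff LIMSEQ_const_iff)
  have 4: "h (x, 0) = f 1" if "x > 0" for x
    using lim[of "(x, 0)"] a1[OF that] that by (simp add: S_set_iff LIMSEQ_const_iff)
  show ?thesis
    using 1 2 3 4 K uniform_limit_step(1)[OF a h] by blast
qed

end

section \<open>Quadratic Taylor remainders of polynomials and the Bernstein basis\<close>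

lemma poly_taylor:
  fixes P :: "real poly"
  shows "\<exists>C\<ge>0. \<forall>a\<in>{0..1}. \<forall>b\<in>{0..1}. \<bar>poly P b - poly P a - poly (pderiv P) a * (b - a)\<bar> \<le> C * (b - a)\<^sup>2"
proof (induction P)
  case 0 show ?case by (intro exI[of _ 0]) auto
next
  case (pCons c Q)
  then obtain C where C: "C \<ge> 0" "\<And>a b. a \<in> {0..1} \<Longrightarrow> b \<in> {0..1} \<Longrightarrow>
      \<bar>poly Q b - poly Q a - poly (pderiv Q) a * (b - a)\<bar> \<le> C * (b - a)\<^sup>2" by blast
  have "bounded (poly (pderiv Q) ` {0..1})"
    by (intro compact_imp_bounded compact_continuous_image continuous_intros) auto
  then obtain D where D: "\<And>z. z \<in> {0..1} \<Longrightarrow> \<bar>poly (pderiv Q) z\<bar> \<le> D" by (auto simp: bounded_iff simp del: atLeastAtMost_iff)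
  have D0: "D \<ge> 0" using D[of 0] by auto
  have "\<bar>poly (pCons c Q) b - poly (pCons c Q) a - poly (pderiv (pCons c Q)) a * (b - a)\<bar> \<le> (C + D) * (b - a)\<^sup>2"
    if ab: "a \<in> {0..1}" "b \<in> {0..1}" for a b
  proof -
    \<comment> \<open>The remainder of \<open>c + X * Q\<close> is \<open>b\<close> times the
      remainder of \<open>Q\<close>, plus a term that is already quadratic in
      \<open>b - a\<close>.\<close>
    have "poly (pCons c Q) b - poly (pCons c Q) a - poly (pderiv (pCons c Q)) a * (b - a) =
        b * (poly Q b - poly Q a - poly (pderiv Q) a * (b - a)) + (b - a)\<^sup>2 * poly (pderiv Q) a"
      by (simp add: pderiv_pCons power2_eq_square algebra_simps)
    also have "\<bar>\<dots>\<bar> \<le> \<bar>b\<bar> * \<bar>poly Q b - poly Q a - poly (pderiv Q) a * (b - a)\<bar> + (b - a)\<^sup>2 * \<bar>poly (pderiv Q) a\<bar>"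
      by (rule order_trans[OF abs_triangle_ineq]) (simp add: abs_mult)
    also have "\<dots> \<le> 1 * (C * (b - a)\<^sup>2) + (b - a)\<^sup>2 * D"
      using C ab D by (intro add_mono mult_mono) auto
    finally show ?thesis by (simp add: algebra_simps)
  qed
  then show ?case using C(1) D0 by (intro exI[of _ "C + D"]) auto
qed

lemma (in urn) harmonic_poly:
  fixes P :: "real poly"
  shows "\<exists>h K. bc h \<and> K \<ge> 0 \<and> (\<forall>p\<in>S_set. step h p = h p)
    \<and> (\<forall>p\<in>S_set. \<bar>h p - poly P (proportion p)\<bar> \<le> K * inv_total p)
    \<and> (\<forall>y>0. h (0, y) = poly P 0) \<and> (\<forall>x>0. h (x, 0) = poly P 1)"
proof -
  obtain C where C: "C \<ge> 0" "\<And>a b. a \<in> {0..1} \<Longrightarrow> b \<in> {0..1} \<Longrightarrow>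
      \<bar>poly P b - poly P a - poly (pderiv P) a * (b - a)\<bar> \<le> C * (b - a)\<^sup>2" using poly_taylor[of P] by blast
  have "bounded (poly (pderiv P) ` {0..1})"
    by (intro compact_imp_bounded compact_continuous_image continuous_intros) auto
  then obtain D where D: "\<And>z. z \<in> {0..1} \<Longrightarrow> \<bar>poly (pderiv P) z\<bar> \<le> D" by (auto simp: bounded_iff simp del: atLeastAtMost_iff)
  have D0: "D \<ge> 0" using D[of 0] by auto
  show ?thesis
    by (rule harmonic_exists[OF _ C(2) D D0 C(1)]) (auto intro: continuous_intros)
qed

lemma (in urn) harmonic_Bernstein:
  "\<exists>h K. bc h \<and> K \<ge> 0 \<and> (\<forall>p\<in>S_set. step h p = h p)
    \<and> (\<forall>p\<in>S_set. \<bar>h p - Bernstein n k (proportion p)\<bar> \<le> K * inv_total p)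
    \<and> (\<forall>y>0. h (0, y) = Bernstein n k 0) \<and> (\<forall>x>0. h (x, 0) = Bernstein n k 1)"
proof -
  have "Bernstein n k z = poly (smult (of_nat (n choose k)) (monom 1 k * [:1, -1:] ^ (n - k))) z" for z
    by (simp add: Bernstein_def poly_monom)
  then show ?thesis using harmonic_poly[of "smult (of_nat (n choose k)) (monom 1 k * [:1, -1:] ^ (n - k))"]
    by presburger
qed

section \<open>The Wasserstein metric\<close>

lemma Prob_on_sets:
  assumes "M \<in> Prob_on 0 1"
  shows "A \<in> sets M \<longleftrightarrow> A \<subseteq> {0..1} \<and> A \<in> sets borel"
  using Prob_onD(2)[OF assms] by (simp add: sets_restrict_space_iff)

lemma Prob_on_Icc: "M \<in> Prob_on 0 1 \<Longrightarrow> t \<le> 1 \<Longrightarrow> {0..t} \<in> sets M"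
  by (auto simp: Prob_on_sets)

lemma Prob_on_measure_le_1: "M \<in> Prob_on 0 1 \<Longrightarrow> measure M A \<le> 1"
  by (rule prob_space.prob_le_1[OF Prob_onD(1)])

lemma Prob_on_measure_unit: "M \<in> Prob_on 0 1 \<Longrightarrow> measure M {0..1} = 1"
  using prob_space.prob_space[OF Prob_onD(1)] Prob_onD(3) by metis

lemma Prob_on_measure_diff_le_1:
  assumes "M \<in> Prob_on 0 1" "N \<in> Prob_on 0 1"
  shows "\<bar>measure M A - measure N A\<bar> \<le> 1"
  using Prob_on_measure_le_1[OF assms(1), of A] Prob_on_measure_le_1[OF assms(2), of A]
    measure_nonneg[of M A] measure_nonneg[of N A] by linarith

lemma Prob_on_cdf_mono:
  assumes M: "M \<in> Prob_on 0 1" and "s \<le> t" "t \<le> 1"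
  shows "measure M {0..s} \<le> measure M {0..t}"
proof -
  interpret prob_space M using Prob_onD(1)[OF M] .
  show ?thesis using assms by (intro finite_measure_mono Prob_on_Icc) auto
qed

text \<open>Lebesgue measure on the unit interval is a probability space, so constants are
  integrable and Fubini applies to its product with an increment law.\<close>

abbreviation unit_interval :: "real measure" where
  "unit_interval \<equiv> restrict_space lborel {0..1}"

lemma prob_space_unit_interval: "prob_space unit_interval"
  by (auto simp: space_restrict_space emeasure_restrict_space intro!: prob_spaceI)

lemma cdf_measurable:
  assumes "M \<in> Prob_on 0 1"
  shows "(\<lambda>t. measure M {0..t}) \<in> borel_measurable unit_interval"
proof -
  have "(\<lambda>t. measure M {0..t}) \<in> borel_measurable (restrict_space borel {0..1})"
    by (intro borel_measurable_mono_on_fnc mono_onI Prob_on_cdf_mono assms) auto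
  moreover have "sets unit_interval = sets (restrict_space borel {0..1::real})"
    by (simp add: sets_restrict_space)
  ultimately show ?thesis using measurable_cong_sets[of _ _ borel borel] by blast
qed

lemma unit_interval_integrable:
  assumes "f \<in> borel_measurable unit_interval" "\<And>t. t \<in> {0..1} \<Longrightarrow> \<bar>f t\<bar> \<le> B"
  shows "integrable unit_interval (f :: real \<Rightarrow> real)"
proof -
  interpret prob_space unit_interval by (rule prob_space_unit_interval)
  show ?thesis using assms by (intro integrable_const_bound[where B=B]) (auto simp: space_restrict_space)
qed

lemma dW_integrable:
  assumes "M \<in> Prob_on 0 1" "N \<in> Prob_on 0 1"
  shows "integrable unit_interval (\<lambda>t. \<bar>measure M {0..t} - measure N {0..t}\<bar>)"
proof (rule unit_interval_integrable[of _ 1])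
  show "(\<lambda>t. \<bar>measure M {0..t} - measure N {0..t}\<bar>) \<in> borel_measurable unit_interval"
    using cdf_measurable assms by measurable
  show "\<bar>\<bar>measure M {0..t} - measure N {0..t}\<bar>\<bar> \<le> 1" for t
    using Prob_on_measure_diff_le_1[OF assms] by simp
qed

text \<open>\<open>dW\<close> is defined by a gauge integral; the Lebesgue form gives access to
  monotone comparison, dominated convergence and Fubini.\<close>

lemma dW_eq:
  assumes "M \<in> Prob_on 0 1" "N \<in> Prob_on 0 1"
  shows "dW M N = (\<integral>t. \<bar>measure M {0..t} - measure N {0..t}\<bar> \<partial>unit_interval)"
proof -
  have "set_integrable lborel {0..1} (\<lambda>t. \<bar>measure M {0..t} - measure N {0..t}\<bar>)"
    using dW_integrable[OF assms] by (simp add: set_integrable_def integrable_restrict_space)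
  from set_borel_integral_eq_integral(2)[OF this]
  show ?thesis by (simp add: dW_def set_lebesgue_integral_def integral_restrict_space)
qed

lemma dW_nonneg: "M \<in> Prob_on 0 1 \<Longrightarrow> N \<in> Prob_on 0 1 \<Longrightarrow> 0 \<le> dW M N"
  by (simp add: dW_eq)

lemma dW_commute: "dW M N = dW N M"
  by (simp add: dW_def abs_minus_commute)

lemma dW_refl: "dW M M = 0"
  by (simp add: dW_def)

lemma dW_le:
  assumes "M \<in> Prob_on 0 1" "N \<in> Prob_on 0 1"
    and "\<And>t. t \<in> {0..1} \<Longrightarrow> \<bar>measure M {0..t} - measure N {0..t}\<bar> \<le> g t" "integrable unit_interval g"
  shows "dW M N \<le> (\<integral>t. g t \<partial>unit_interval)"
  unfolding dW_eq[OF assms(1,2)] using assms(3)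
  by (intro integral_mono dW_integrable assms) (auto simp: space_restrict_space)

lemma dW_le_1:
  assumes "M \<in> Prob_on 0 1" "N \<in> Prob_on 0 1"
  shows "dW M N \<le> 1"
proof -
  interpret prob_space unit_interval by (rule prob_space_unit_interval)
  have "\<bar>measure M {0..t} - measure N {0..t}\<bar> \<le> 1" for t
    by (rule Prob_on_measure_diff_le_1[OF assms])
  then have "dW M N \<le> (\<integral>t. 1 \<partial>unit_interval)" by (intro dW_le assms) auto
  then show ?thesis using prob_space by simp
qed

lemma dW_triangle:
  assumes "M \<in> Prob_on 0 1" "N \<in> Prob_on 0 1" "L \<in> Prob_on 0 1"
  shows "dW M L \<le> dW M N + dW N L"
proof -
  have "dW M L \<le> (\<integral>t. \<bar>measure M {0..t} - measure N {0..t}\<bar> + \<bar>measure N {0..t} - measure L {0..t}\<bar> \<partial>unit_interval)"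
    by (intro dW_le assms Bochner_Integration.integrable_add dW_integrable) linarith
  also have "\<dots> = dW M N + dW N L"
    by (simp add: dW_eq assms dW_integrable)
  finally show ?thesis .
qed

lemma dW_abs_diff:
  assumes "A \<in> Prob_on 0 1" "B \<in> Prob_on 0 1" "C \<in> Prob_on 0 1" "D \<in> Prob_on 0 1"
  shows "\<bar>dW A B - dW C D\<bar> \<le> dW A C + dW B D"
  using dW_triangle[of A C B] dW_triangle[of C D B] dW_triangle[of C A D] dW_triangle[of A B D] assms
    dW_commute[of A C] dW_commute[of B D] by linarith

text \<open>Between \<open>t\<close> and \<open>u\<close> the distribution function of
  \<open>N\<close> is at least its value at \<open>t\<close>, and that of \<open>M\<close> at most
  its value at \<open>u\<close>. The gap between \<open>t\<close> and \<open>u\<close> is the price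
  for extracting pointwise information from an integral distance.\<close>

lemma dW_lower_bound:
  assumes M: "M \<in> Prob_on 0 1" and N: "N \<in> Prob_on 0 1"
    and t: "0 \<le> t" "t \<le> u" "u \<le> 1"
  shows "(u - t) * (measure N {0..t} - measure M {0..u}) \<le> dW M N"
proof -
  define c where "c = measure N {0..t} - measure M {0..u}"
  have "(u - t) * c = (\<integral>s. indicator {t..u} s * c \<partial>unit_interval)"
    using t by (simp add: measure_restrict_space)
  also have "\<dots> \<le> dW M N"
    unfolding dW_eq[OF M N]
  proof (intro integral_mono dW_integrable M N)
    show "integrable unit_interval (\<lambda>s. indicator {t..u} s * c)"
      by (rule unit_interval_integrable[of _ "\<bar>c\<bar>"]) (auto simp: indicator_def intro!: measurable_restrict_space1)
    fix s
    show "indicator {t..u} s * c \<le> \<bar>measure M {0..s} - measure N {0..s}\<bar>"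
      using t Prob_on_cdf_mono[OF N, of t s] Prob_on_cdf_mono[OF M, of s u]
      by (auto simp: indicator_def c_def)
  qed
  finally show ?thesis by (simp add: c_def)
qed

lemma cdf_right_continuous:
  assumes M: "M \<in> Prob_on 0 1" and t: "0 \<le> t" "t < 1" and a: "measure M {0..t} < a"
  obtains u where "t < u" "u \<le> 1" "measure M {0..u} < a"
proof -
  interpret prob_space M using Prob_onD(1)[OF M] .
  define A where "A n = {0..t + (1 - t) / real (Suc n)}" for n
  have le: "t + (1 - t) / real (Suc n) \<le> 1" for n
  proof -
    have "(1 - t) / real (Suc n) \<le> (1 - t) / 1" using t by (intro divide_left_mono) auto
    then show ?thesis by simp
  qed
  have "(\<lambda>n. measure M (A n)) \<longlonglongrightarrow> measure M (\<Inter>n. A n)"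
  proof (rule finite_Lim_measure_decseq)
    show "range A \<subseteq> sets M" using Prob_on_Icc[OF M le] by (auto simp: A_def)
    have "(1 - t) / real (Suc n) \<le> (1 - t) / real (Suc m)" if "m \<le> n" for m n
      using t that by (intro divide_left_mono) auto
    then show "decseq A" unfolding decseq_def A_def by fastforce
  qed
  also have "(\<Inter>n. A n) = {0..t}"
  proof (intro equalityI subsetI)
    fix x assume x: "x \<in> (\<Inter>n. A n)"
    have lim: "(\<lambda>n. t + (1 - t) * (1 / real (Suc n))) \<longlonglongrightarrow> t + (1 - t) * 0"
      by (intro tendsto_intros LIMSEQ_Suc[OF lim_1_over_n])
    have "x \<le> t + (1 - t) * 0"
      by (rule LIMSEQ_le_const[OF lim]) (use x in \<open>auto simp: A_def\<close>)
    then show "x \<in> {0..t}" using x by (auto simp: A_def)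
  next
    fix x assume "x \<in> {0..t}"
    then show "x \<in> (\<Inter>n. A n)" using t by (auto simp: A_def intro: add_increasing2)
  qed
  finally have "\<forall>\<^sub>F n in sequentially. measure M (A n) < a"
    using a by (rule order_tendstoD(2))
  then obtain n where "measure M (A n) < a" by (auto simp: eventually_sequentially)
  then show thesis using t le[of n] by (intro that[of "t + (1 - t) / real (Suc n)"]) (auto simp: A_def)
qed

lemma unit_borel_generated:
  "sets (restrict_space borel {0..1::real}) = sigma_sets {0..1} {{0..t} | t. t \<le> 1}" (is "_ = sigma_sets _ ?E")
proof -
  have "sets (restrict_space borel {0..1::real}) = sigma_sets {0..1} (((\<inter>) {0..1}) ` range (\<lambda>a::real. {..a}))"
  proof -
    have "sets borel = sigma_sets UNIV (range (\<lambda>a::real. {..a}))"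
      unfolding borel_eq_atMost by (rule sets_measure_of) simp
    moreover from this have "{0..1::real} \<in> sigma_sets UNIV (range (\<lambda>a::real. {..a}))"
      by (metis atLeastAtMost_borel)
    ultimately show ?thesis
      unfolding sets_restrict_space by (simp add: restricted_sigma)
  qed
  also have "((\<inter>) {0..1}) ` range (\<lambda>a::real. {..a}) = ?E"
  proof (intro equalityI subsetI)
    fix A assume "A \<in> ((\<inter>) {0..1}) ` range (\<lambda>a::real. {..a})"
    then obtain a where "A = {0..1} \<inter> {..a}" by blast
    then have "A = {0..min a 1}" by auto
    then show "A \<in> ?E" using min.cobounded2[of a 1] by blast
  next
    fix A assume "A \<in> ?E"
    then obtain t where "t \<le> 1" "A = {0..t}" by auto
    then have "A = {0..1} \<inter> {..t}" by auto
    then show "A \<in> ((\<inter>) {0..1}) ` range (\<lambda>a::real. {..a})" by blast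
  qed
  finally show ?thesis .
qed

lemma Int_stable_unit_Icc: "Int_stable {{0..t} | t. t \<le> (1::real)}"
  by (rule Int_stableI) (auto simp: min_def)

text \<open>Uniqueness of measures on an intersection-stable generator; at \<open>t = 1\<close> both
  sides are the total mass.\<close>

lemma Prob_on_eqI:
  assumes M: "M \<in> Prob_on 0 1" and N: "N \<in> Prob_on 0 1"
    and eq: "\<And>t. 0 \<le> t \<Longrightarrow> t < 1 \<Longrightarrow> measure M {0..t} = measure N {0..t}"
  shows "M = N"
proof (rule measure_eqI_generator_eq)
  interpret M: prob_space M using Prob_onD(1)[OF M] .
  interpret N: prob_space N using Prob_onD(1)[OF N] .
  let ?E = "{{0..t} | t. t \<le> (1::real)}"
  show "Int_stable ?E" by (rule Int_stable_unit_Icc)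
  show "?E \<subseteq> Pow {0..1}" by auto
  show "sets M = sigma_sets {0..1} ?E" "sets N = sigma_sets {0..1} ?E"
    using Prob_onD(2)[OF M] Prob_onD(2)[OF N] unit_borel_generated by auto
  show "range (\<lambda>_::nat. {0..1::real}) \<subseteq> ?E" by auto
  show "(\<Union>i::nat. {0..1::real}) = {0..1}" by auto
  show "emeasure M {0..1} \<noteq> \<infinity>" by (simp add: M.emeasure_eq_measure)
  fix A assume "A \<in> ?E"
  then obtain t where t: "t \<le> 1" "A = {0..t}" by auto
  have "measure M A = measure N A"
    using eq[of t] t Prob_on_measure_unit[OF M] Prob_on_measure_unit[OF N]
    by (cases "t < 0"; cases "t = 1") auto
  then show "emeasure M A = emeasure N A"
    by (simp add: M.emeasure_eq_measure N.emeasure_eq_measure)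
qed

text \<open>A strict inequality at \<open>t\<close> in the other direction survives a small shift to
  the right in the distribution function of \<open>M\<close>, and \<open>dW_lower_bound\<close> then
  makes the distance positive.\<close>

lemma dW_eq_0_cdf_le:
  assumes M: "M \<in> Prob_on 0 1" and N: "N \<in> Prob_on 0 1" and "dW M N = 0" "0 \<le> t" "t < 1"
  shows "measure N {0..t} \<le> measure M {0..t}"
proof (rule ccontr)
  assume "\<not> measure N {0..t} \<le> measure M {0..t}"
  then obtain u where u: "t < u" "u \<le> 1" "measure M {0..u} < measure N {0..t}"
    using cdf_right_continuous[OF M, of t "measure N {0..t}"] assms by auto
  then have "0 < (u - t) * (measure N {0..t} - measure M {0..u})" by simp
  then show False using dW_lower_bound[OF M N, of t u] u assms by linarith
qed

lemma dW_eq_0D: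
  assumes "M \<in> Prob_on 0 1" "N \<in> Prob_on 0 1" "dW M N = 0"
  shows "M = N"
  using dW_eq_0_cdf_le[OF assms] dW_eq_0_cdf_le[OF assms(2,1)] assms(3) dW_commute[of M N]
  by (intro Prob_on_eqI[OF assms(1,2)]) (auto intro: antisym)

section \<open>Finite mixtures of probability measures\<close>

lemma Prob_on_mixture:
  fixes w :: "nat \<Rightarrow> real"
  assumes N: "\<And>k. k \<le> n \<Longrightarrow> N k \<in> Prob_on 0 1" and w: "\<And>k. k \<le> n \<Longrightarrow> 0 \<le> w k" "(\<Sum>k\<le>n. w k) = 1"
  shows "\<exists>M\<in>Prob_on 0 1. \<forall>A\<in>sets (restrict_space borel {0..1}).
    measure M A = (\<Sum>k\<le>n. w k * measure (N k) A)"
proof -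
  let ?B = "restrict_space borel {0..1::real}"
  let ?P = "point_measure {..n} w"
  interpret P: prob_space ?P
  proof (rule prob_spaceI)
    have "emeasure ?P (space ?P) = (\<Sum>k\<le>n. ennreal (w k))"
      by (simp add: emeasure_point_measure_finite space_point_measure)
    also have "\<dots> = ennreal (\<Sum>k\<le>n. w k)" using w by (intro sum_ennreal) auto
    finally show "emeasure ?P (space ?P) = 1" using w by simp
  qed
  have meas: "N \<in> measurable ?P (subprob_algebra ?B)"
    using N by (auto simp: measurable_def space_point_measure sets_point_measure space_subprob_algebra
        Prob_on_def intro: prob_space_imp_subprob_space)
  \<comment> \<open>Drawing an index with law \<open>w\<close> and then a point with law
    \<open>N k\<close> produces the mixture, so its countable additivity comes with the monadic
    bind.\<close>
  define M where "M = ?P \<bind> N"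
  have em: "emeasure M A = (\<Sum>k\<le>n. ennreal (w k) * emeasure (N k) A)" if "A \<in> sets ?B" for A
    unfolding M_def
    by (subst emeasure_bind[OF _ meas that])
       (auto simp: space_point_measure nn_integral_point_measure_finite mult.commute)
  have "prob_space M" unfolding M_def
    by (rule P.prob_space_bind[OF _ meas]) (use N in \<open>auto simp: space_point_measure Prob_on_def intro!: AE_I2\<close>)
  moreover have "sets M = sets ?B" unfolding M_def
    by (rule sets_bind) (use N in \<open>auto simp: space_point_measure Prob_on_def\<close>)
  ultimately have M: "M \<in> Prob_on 0 1" by (simp add: Prob_on_def)
  moreover have "measure M A = (\<Sum>k\<le>n. w k * measure (N k) A)" if "A \<in> sets ?B" for A
  proof -
    have "emeasure M A = (\<Sum>k\<le>n. ennreal (w k * measure (N k) A))"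
      unfolding em[OF that]
    proof (intro sum.cong refl)
      fix k assume "k \<in> {..n}"
      then have k: "k \<le> n" by simp
      interpret prob_space "N k" using Prob_onD(1)[OF N[OF k]] .
      show "ennreal (w k) * emeasure (N k) A = ennreal (w k * measure (N k) A)"
        using w(1)[OF k] by (simp add: emeasure_eq_measure ennreal_mult)
    qed
    also have "\<dots> = ennreal (\<Sum>k\<le>n. w k * measure (N k) A)"
      using w by (intro sum_ennreal) auto
    moreover have "0 \<le> (\<Sum>k\<le>n. w k * measure (N k) A)"
      using w by (intro sum_nonneg mult_nonneg_nonneg) auto
    ultimately show ?thesis by (simp add: measure_def[of M])
  qed
  ultimately show ?thesis by blast
qed

text \<open>Convexity of the distance in one argument: as the weights sum to 1, \<open>L\<close> is
  the mixture of copies of itself.\<close>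

lemma dW_mixture_le:
  fixes w :: "nat \<Rightarrow> real"
  assumes M: "M \<in> Prob_on 0 1" and L: "L \<in> Prob_on 0 1" and N: "\<And>k. k \<le> n \<Longrightarrow> N k \<in> Prob_on 0 1"
    and w: "\<And>k. k \<le> n \<Longrightarrow> 0 \<le> w k" "(\<Sum>k\<le>n. w k) = 1"
    and eq: "\<And>t. t \<in> {0..1} \<Longrightarrow> measure M {0..t} = (\<Sum>k\<le>n. w k * measure (N k) {0..t})"
  shows "dW M L \<le> (\<Sum>k\<le>n. w k * dW (N k) L)"
proof -
  have "dW M L \<le> (\<integral>t. (\<Sum>k\<le>n. w k * \<bar>measure (N k) {0..t} - measure L {0..t}\<bar>) \<partial>unit_interval)"
  proof (intro dW_le M L Bochner_Integration.integrable_sum integrable_mult_right)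
    fix t :: real assume t: "t \<in> {0..1}"
    have "measure L {0..t} = (\<Sum>k\<le>n. w k * measure L {0..t})"
      by (simp add: sum_distrib_right[symmetric] w)
    then have "measure M {0..t} - measure L {0..t} = (\<Sum>k\<le>n. w k * (measure (N k) {0..t} - measure L {0..t}))"
      unfolding eq[OF t] right_diff_distrib sum_subtractf by simp
    then show "\<bar>measure M {0..t} - measure L {0..t}\<bar> \<le> (\<Sum>k\<le>n. w k * \<bar>measure (N k) {0..t} - measure L {0..t}\<bar>)"
      using sum_abs[of "\<lambda>k. w k * (measure (N k) {0..t} - measure L {0..t})" "{..n}"] w by (simp add: abs_mult)
  qed (use N L in \<open>auto intro: dW_integrable\<close>)
  also have "\<dots> = (\<Sum>k\<le>n. w k * dW (N k) L)"
    using N L by (subst Bochner_Integration.integral_sum) (auto simp: dW_integrable dW_eq)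
  finally show ?thesis .
qed

text \<open>With the components fixed and distribution functions bounded by 1, a change of weights
  costs at most its l1 norm. Continuous weights thus give continuous mixtures.\<close>

lemma dW_mixtures_le:
  fixes a b :: "nat \<Rightarrow> real"
  assumes M: "M \<in> Prob_on 0 1" "M' \<in> Prob_on 0 1" and N: "\<And>k. k \<le> n \<Longrightarrow> N k \<in> Prob_on 0 1"
    and eq: "\<And>t. t \<in> {0..1} \<Longrightarrow> measure M {0..t} = (\<Sum>k\<le>n. a k * measure (N k) {0..t})"
      "\<And>t. t \<in> {0..1} \<Longrightarrow> measure M' {0..t} = (\<Sum>k\<le>n. b k * measure (N k) {0..t})"
  shows "dW M M' \<le> (\<Sum>k\<le>n. \<bar>a k - b k\<bar>)"
proof -
  interpret prob_space unit_interval by (rule prob_space_unit_interval)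
  have "dW M M' \<le> (\<integral>t. (\<Sum>k\<le>n. \<bar>a k - b k\<bar>) \<partial>unit_interval)"
  proof (intro dW_le M)
    fix t :: real assume t: "t \<in> {0..1}"
    have "\<bar>measure M {0..t} - measure M' {0..t}\<bar> = \<bar>\<Sum>k\<le>n. (a k - b k) * measure (N k) {0..t}\<bar>"
      unfolding eq[OF t] left_diff_distrib sum_subtractf ..
    also have "\<dots> \<le> (\<Sum>k\<le>n. \<bar>(a k - b k) * measure (N k) {0..t}\<bar>)" by (rule sum_abs)
    also have "\<dots> \<le> (\<Sum>k\<le>n. \<bar>a k - b k\<bar>)"
      using Prob_on_measure_le_1[OF N] by (intro sum_mono) (auto simp: abs_mult intro!: mult_left_le)
    finally show "\<bar>measure M {0..t} - measure M' {0..t}\<bar> \<le> (\<Sum>k\<le>n. \<bar>a k - b k\<bar>)" .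
  qed simp
  then show ?thesis using prob_space by simp
qed

section \<open>Completeness and kernels\<close>

text \<open>Tightness yields a weakly convergent subsequence. Its distribution functions converge at
  all but countably many points, so dominated convergence turns this into convergence in
  \<open>dW\<close>, and the Cauchy property extends it to the whole sequence.\<close>

lemma dW_complete:
  fixes M :: "nat \<Rightarrow> real measure"
  assumes M: "\<And>n. M n \<in> Prob_on 0 1"
    and Cauchy: "\<And>e. e > 0 \<Longrightarrow> \<exists>N. \<forall>m\<ge>N. \<forall>n\<ge>N. dW (M m) (M n) < e"
  shows "\<exists>L\<in>Prob_on 0 1. \<forall>e>0. \<exists>N. \<forall>n\<ge>N. dW (M n) L \<le> e"
proof -
  let ?B = "restrict_space borel {0..1::real}"
  \<comment> \<open>The laws are moved to the whole line, where the compactness theorem for tight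
    sequences is available.\<close>
  define P where "P n = distr (M n) borel (\<lambda>x. x)" for n
  have meas: "(\<lambda>x. x) \<in> measurable (M n) borel" for n
  proof -
    have "(\<lambda>x. x) \<in> measurable ?B borel" by (intro measurable_restrict_space1) auto
    then show ?thesis using measurable_cong_sets[OF Prob_onD(2)[OF M] refl] by auto
  qed
  have mP: "measure (P n) A = measure (M n) (A \<inter> {0..1})" if "A \<in> sets borel" for n A
    unfolding P_def using measure_distr[OF meas that] by (simp add: Prob_onD(3)[OF M])
  have rd: "real_distribution (P n)" for n
  proof -
    interpret prob_space "P n" unfolding P_def by (rule prob_space.prob_space_distr[OF Prob_onD(1)[OF M] meas])
    show ?thesis by unfold_locales (simp add: P_def)
  qed
  have "tight P"
    unfolding tight_def
  proof (intro conjI allI impI rd)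
    fix e :: real assume "e > 0"
    have "{-1<..1::real} \<inter> {0..1} = {0..1}" by auto
    then have "measure (P n) {-1<..1} = 1" for n
      using mP[of "{-1<..1}"] Prob_on_measure_unit[OF M] by simp
    then have "(-1::real) < 1 \<and> (\<forall>n. measure (P n) {-1<..1} > 1 - e)" using \<open>e > 0\<close> by simp
    then show "\<exists>a b. a < b \<and> (\<forall>n. measure (P n) {a<..b} > 1 - e)" by blast
  qed
  from tight_imp_convergent_subsubsequence[OF this strict_mono_id] obtain r Q where
    r: "strict_mono r" and Q: "real_distribution Q" and w: "weak_conv_m (P \<circ> id \<circ> r) Q" by blast
  interpret Q: real_distribution Q by (rule Q)
  \<comment> \<open>Clamping turns the limit law on the line into a measure on the unit interval and
    keeps its distribution function on \<open>[0,1)\<close>. The support of the limit therefore does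
    not have to be determined.\<close>
  define clamp :: "real \<Rightarrow> real" where "clamp x = max 0 (min 1 x)" for x
  have clamp: "clamp \<in> measurable Q ?B"
    unfolding clamp_def by (intro measurable_restrict_space2) auto
  define L where "L = distr Q ?B clamp"
  have L: "L \<in> Prob_on 0 1"
    unfolding L_def Prob_on_def by (simp add: Q.prob_space_distr[OF clamp])
  have mL: "measure L {0..t} = cdf Q t" if t: "0 \<le> t" "t < 1" for t
  proof -
    have "{0..t} \<in> sets ?B" using t by (auto simp: sets_restrict_space_iff)
    then have "measure L {0..t} = measure Q (clamp -` {0..t} \<inter> space Q)"
      unfolding L_def by (rule measure_distr[OF clamp])
    also have "clamp -` {0..t} \<inter> space Q = {..t}"
      using t by (auto simp: clamp_def max_def min_def split: if_splits)
    finally show ?thesis by (simp add: cdf_def)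
  qed
  have mPr: "cdf (P n) t = measure (M n) {0..t}" if t: "0 \<le> t" "t < 1" for n t
  proof -
    have eq: "{..t} \<inter> {0..1} = {0..t}" using t by auto
    have "{..t} \<in> sets borel" by simp
    then show ?thesis by (simp only: cdf_def mP eq)
  qed
  \<comment> \<open>The point 1 joins the discontinuities because the distribution functions were
    identified only below 1; the exceptional set remains null.\<close>
  have ctbl: "countable ({t. \<not> isCont (cdf Q) t} \<union> {1})"
    using Q.cdf_nondecreasing by (intro countable_Un mono_ctble_discont monoI) auto
  interpret U: prob_space unit_interval by (rule prob_space_unit_interval)
  have "(\<lambda>n. \<integral>t. \<bar>measure (M (r n)) {0..t} - measure L {0..t}\<bar> \<partial>unit_interval) \<longlonglongrightarrow> (\<integral>t. 0 \<partial>unit_interval)"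
  proof (rule integral_dominated_convergence[where w="\<lambda>_. 1"])
    show "(\<lambda>t. \<bar>measure (M (r n)) {0..t} - measure L {0..t}\<bar>) \<in> borel_measurable unit_interval" for n
      using dW_integrable[OF M L] by auto
    show "AE t in unit_interval. norm \<bar>measure (M (r n)) {0..t} - measure L {0..t}\<bar> \<le> 1" for n
      using Prob_on_measure_diff_le_1[OF M L] by simp
    show "AE t in unit_interval. (\<lambda>n. \<bar>measure (M (r n)) {0..t} - measure L {0..t}\<bar>) \<longlonglongrightarrow> 0"
    proof -
      have "AE t in lborel. t \<notin> {t. \<not> isCont (cdf Q) t} \<union> {1}"
        by (intro AE_not_in countable_imp_null_set_lborel ctbl)
      then have "AE t in lborel. t \<in> {0..1} \<longrightarrow> (\<lambda>n. \<bar>measure (M (r n)) {0..t} - measure L {0..t}\<bar>) \<longlonglongrightarrow> 0"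
      proof eventually_elim
        fix t assume t: "t \<notin> {t. \<not> isCont (cdf Q) t} \<union> {1}"
        show "t \<in> {0..1} \<longrightarrow> (\<lambda>n. \<bar>measure (M (r n)) {0..t} - measure L {0..t}\<bar>) \<longlonglongrightarrow> 0"
        proof
          assume "t \<in> {0..1}"
          with t have t': "0 \<le> t" "t < 1" "isCont (cdf Q) t" by auto
          have "(\<lambda>n. cdf (P (r n)) t) \<longlonglongrightarrow> cdf Q t"
            using w t' by (auto simp: weak_conv_m_def weak_conv_def)
          then have "(\<lambda>n. measure (M (r n)) {0..t} - measure L {0..t}) \<longlonglongrightarrow> 0"
            using t' by (simp add: mPr mL LIM_zero_iff)
          then show "(\<lambda>n. \<bar>measure (M (r n)) {0..t} - measure L {0..t}\<bar>) \<longlonglongrightarrow> 0"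
            by (rule tendsto_rabs_zero)
        qed
      qed
      then show ?thesis by (subst AE_restrict_space_iff) auto
    qed
  qed auto
  then have lim: "(\<lambda>n. dW (M (r n)) L) \<longlonglongrightarrow> 0" by (simp add: dW_eq[OF M L])
  have "\<exists>N. \<forall>n\<ge>N. dW (M n) L \<le> e" if e: "e > 0" for e
  proof -
    obtain N where N: "\<And>m n. m \<ge> N \<Longrightarrow> n \<ge> N \<Longrightarrow> dW (M m) (M n) < e / 2"
      using Cauchy[of "e/2"] e by auto
    have "\<forall>\<^sub>F n in sequentially. dW (M (r n)) L < e / 2"
      using lim e by (intro order_tendstoD(2)[OF lim]) auto
    then obtain N' where N': "\<And>n. n \<ge> N' \<Longrightarrow> dW (M (r n)) L < e / 2"
      by (auto simp: eventually_sequentially)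
    define k where "k = max N N'"
    have "r k \<ge> N" using seq_suble[OF r, of k] by (simp add: k_def)
    then have "dW (M n) L \<le> e" if "n \<ge> N" for n
      using N[OF that \<open>r k \<ge> N\<close>] N'[of k] dW_triangle[OF M M L, of n "r k"] by (simp add: k_def)
    then show ?thesis by blast
  qed
  then show ?thesis using L by blast
qed

section \<open>Continuous measure-valued maps as Markov kernels\<close>

lemma cont_SD: "cont_S G \<Longrightarrow> p \<in> S_set \<Longrightarrow> G p \<in> Prob_on 0 1"
  by (simp add: cont_S_def)

lemma cont_S_sets: "cont_S G \<Longrightarrow> p \<in> S_set \<Longrightarrow> sets (G p) = sets (restrict_space borel {0..1})"
  by (rule Prob_onD(2)[OF cont_SD])

text \<open>Evaluation of the distribution function is upper semicontinuous for the Wasserstein metric.\<close>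

lemma cont_S_cdf_measurable:
  assumes G: "cont_S G" and t: "0 \<le> t" "t \<le> 1"
  shows "(\<lambda>p. measure (G p) {0..t}) \<in> borel_measurable (restrict_space borel S_set)"
\<comment> \<open>The semicontinuity argument needs room to the right of \<open>t\<close>; at 1 the
  function is constant.\<close>
proof (cases "t = 1")
  case True
  then have "(\<lambda>p. measure (G p) {0..t}) \<in> borel_measurable (restrict_space borel S_set) \<longleftrightarrow>
      (\<lambda>p. 1::real) \<in> borel_measurable (restrict_space borel S_set)"
    using Prob_on_measure_unit[OF cont_SD[OF G]] by (intro measurable_cong) (auto simp: space_restrict_space)
  then show ?thesis by simp
next
  case False
  show ?thesis
    unfolding borel_measurable_iff_less
  proof
    fix a
    let ?W = "{p \<in> S_set. measure (G p) {0..t} < a}"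
    have "openin (top_of_set S_set) ?W"
      unfolding openin_euclidean_subtopology_iff
    proof (intro conjI ballI)
      fix p assume "p \<in> ?W"
      then have p: "p \<in> S_set" "measure (G p) {0..t} < a" by auto
      obtain u where u: "t < u" "u \<le> 1" "measure (G p) {0..u} < a"
        by (rule cdf_right_continuous[OF cont_SD[OF G p(1)] t(1) _ p(2)]) (use t False in auto)
      \<comment> \<open>Chosen so that \<open>dW_lower_bound\<close> at a point \<open>q\<close>
        with distance below \<open>e\<close>, after division by \<open>u - t\<close>, reads
        \<open>measure (G q) {0..t} < a\<close>.\<close>
      define e where "e = (u - t) * (a - measure (G p) {0..u})"
      have "e > 0" using u by (simp add: e_def)
      then obtain d where d: "d > 0" "\<And>q. q \<in> S_set \<Longrightarrow> dist q p < d \<Longrightarrow> dW (G q) (G p) < e"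
        using G p(1) unfolding cont_S_def by blast
      have "q \<in> ?W" if q: "q \<in> S_set" "dist q p < d" for q
      proof -
        have "(u - t) * (measure (G q) {0..t} - measure (G p) {0..u}) \<le> dW (G p) (G q)"
          using u t by (intro dW_lower_bound cont_SD[OF G] p q) auto
        also have "\<dots> < (u - t) * (a - measure (G p) {0..u})"
          using d(2)[OF q] by (simp add: e_def dW_commute)
        finally show ?thesis using u q by simp
      qed
      then show "\<exists>e>0. \<forall>q\<in>S_set. dist q p < e \<longrightarrow> q \<in> ?W" using d(1) by blast
    qed auto
    then obtain T where "open T" "?W = S_set \<inter> T" unfolding openin_open by blast
    then show "{p \<in> space (restrict_space borel S_set). measure (G p) {0..t} < a} \<in> sets (restrict_space borel S_set)"
      by (auto simp: space_restrict_space sets_restrict_space)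
  qed
qed

text \<open>Measurability of the distribution functions extends from the generating intervals to all
  Borel sets. As a kernel, \<open>G\<close> can be integrated against increment laws and fed into
  Fubini.\<close>

lemma cont_S_kernel:
  assumes G: "cont_S G"
  shows "G \<in> measurable (restrict_space borel S_set) (subprob_algebra (restrict_space borel {0..1}))"
proof -
  have "G \<in> measurable (restrict_space borel S_set) (prob_algebra (restrict_space borel {0..1}))"
  proof (rule measurable_prob_algebra_generated[OF unit_borel_generated Int_stable_unit_Icc])
    fix p assume "p \<in> space (restrict_space borel S_set)"
    then have "p \<in> S_set" by (simp add: space_restrict_space)
    then show "prob_space (G p)" "sets (G p) = sets (restrict_space borel {0..1})"
      using Prob_onD[OF cont_SD[OF G]] by auto
  next
    fix A assume "A \<in> {{0..t} | t. t \<le> (1::real)}"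
    then obtain t where t: "t \<le> 1" "A = {0..t}" by auto
    have "(\<lambda>p. ennreal (measure (G p) A)) \<in> borel_measurable (restrict_space borel S_set)"
      using cont_S_cdf_measurable[OF G _ t(1)] t by (cases "t < 0") auto
    moreover have "emeasure (G p) A = ennreal (measure (G p) A)"
      if "p \<in> space (restrict_space borel S_set)" for p
    proof -
      interpret prob_space "G p" using that Prob_onD(1)[OF cont_SD[OF G]] by (simp add: space_restrict_space)
      show ?thesis by (rule emeasure_eq_measure)
    qed
    ultimately show "(\<lambda>p. emeasure (G p) A) \<in> borel_measurable (restrict_space borel S_set)"
      by (subst measurable_cong) auto
  qed auto
  then show ?thesis by (rule measurable_prob_algebraD)
qed

lemma cont_S_bm:
  assumes G: "cont_S G" and A: "A \<in> sets (restrict_space borel {0..1})"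
  shows "bm (\<lambda>p. measure (G p) A)"
proof (rule bmI)
  show "(\<lambda>p. measure (G p) A) \<in> borel_measurable (restrict_space borel S_set)"
    by (rule measurable_compose[OF cont_S_kernel[OF G] measurable_measure_subprob_algebra[OF A]])
  show "\<bar>measure (G p) A\<bar> \<le> 1" if "p \<in> S_set" for p
    using Prob_on_measure_le_1[OF cont_SD[OF G that]] by simp
qed

lemma unit_Icc_sets: "t \<le> 1 \<Longrightarrow> {0..t} \<in> sets (restrict_space borel {0..1::real})"
  by (auto simp: sets_restrict_space_iff)

text \<open>Unlike the mass of a fixed set, the distance of two maps is continuous, by the triangle
  inequality; so the maximum principle can be applied to it.\<close>

lemma cont_S_dW_bc:
  assumes G: "cont_S G" and G': "cont_S G'"
  shows "bc (\<lambda>p. dW (G p) (G' p))"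
proof (rule bcI[of _ 1])
  show "\<bar>dW (G p) (G' p)\<bar> \<le> 1" if "p \<in> S_set" for p
    using dW_le_1[OF cont_SD[OF G that] cont_SD[OF G' that]] dW_nonneg[OF cont_SD[OF G that] cont_SD[OF G' that]]
    by simp
  show "continuous_on S_set (\<lambda>p. dW (G p) (G' p))"
    unfolding continuous_on_iff
  proof (intro ballI allI impI)
    fix p :: "real \<times> real" and e :: real assume p: "p \<in> S_set" and e: "e > 0"
    then have e2: "e / 2 > 0" by simp
    obtain d1 where d1: "d1 > 0" "\<And>q. q \<in> S_set \<Longrightarrow> dist q p < d1 \<Longrightarrow> dW (G q) (G p) < e / 2"
      using G p e2 unfolding cont_S_def by blast
    obtain d2 where d2: "d2 > 0" "\<And>q. q \<in> S_set \<Longrightarrow> dist q p < d2 \<Longrightarrow> dW (G' q) (G' p) < e / 2"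
      using G' p e2 unfolding cont_S_def by blast
    have "dist (dW (G q) (G' q)) (dW (G p) (G' p)) < e" if q: "q \<in> S_set" "dist q p < min d1 d2" for q
      using dW_abs_diff[OF cont_SD[OF G q(1)] cont_SD[OF G' q(1)] cont_SD[OF G p] cont_SD[OF G' p]]
        d1(2)[OF q(1)] d2(2)[OF q(1)] q(2) by (simp add: dist_real_def)
    then show "\<exists>d>0. \<forall>q\<in>S_set. dist q p < d \<longrightarrow> dist (dW (G q) (G' q)) (dW (G p) (G' p)) < e"
      using d1(1) d2(1) by (intro exI[of _ "min d1 d2"]) auto
  qed
qed

text \<open>Fubini for the increment and the argument of the distribution function: averaging the
  pointwise gaps and then integrating over \<open>t\<close> averages the distances.\<close>

lemma avg_dW:
  assumes M: "M \<in> Prob_on 0 \<beta>" and e: "fst e \<ge> 0" "snd e \<ge> 0" and p: "p \<in> S_set"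
    and G: "cont_S G" and G': "cont_S G'"
  defines "F \<equiv> \<lambda>t. avg M e (\<lambda>q. \<bar>measure (G q) {0..t} - measure (G' q) {0..t}\<bar>) p"
  shows "integrable unit_interval F"
    "(\<integral>t. F t \<partial>unit_interval) = avg M e (\<lambda>q. dW (G q) (G' q)) p"
proof -
  interpret M: prob_space M using Prob_onD(1)[OF M] .
  interpret U: prob_space unit_interval by (rule prob_space_unit_interval)
  interpret MU: pair_prob_space M unit_interval ..
  let ?B = "restrict_space borel {0..1::real}"
  let ?g = "\<lambda>k t. \<bar>measure (G (p + k *\<^sub>R e)) {0..t} - measure (G' (p + k *\<^sub>R e)) {0..t}\<bar>"
  note shS = shift_bound[OF M e p]
  \<comment> \<open>The region \<open>s \<le> t\<close> in the product space is measurable; this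
    gives joint measurability of the distribution function in the increment and in
    \<open>t\<close>.\<close>
  have Sig: "(SIGMA x:space (M \<Otimes>\<^sub>M unit_interval). {0..snd x}) \<in> sets ((M \<Otimes>\<^sub>M unit_interval) \<Otimes>\<^sub>M ?B)"
  proof -
    have 1: "(\<lambda>y. snd y) \<in> borel_measurable ((M \<Otimes>\<^sub>M unit_interval) \<Otimes>\<^sub>M ?B)"
      by (rule measurable_compose[OF measurable_snd]) (auto intro: measurable_restrict_space1)
    have 2: "(\<lambda>y. snd (fst y)) \<in> borel_measurable ((M \<Otimes>\<^sub>M unit_interval) \<Otimes>\<^sub>M ?B)"
      by (rule measurable_compose[OF measurable_compose[OF measurable_fst measurable_snd]])
        (auto intro: measurable_restrict_space1)
    have "{y \<in> space ((M \<Otimes>\<^sub>M unit_interval) \<Otimes>\<^sub>M ?B). snd y \<le> snd (fst y)} \<in> sets ((M \<Otimes>\<^sub>M unit_interval) \<Otimes>\<^sub>M ?B)"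
      using 1 2 by measurable
    also have "{y \<in> space ((M \<Otimes>\<^sub>M unit_interval) \<Otimes>\<^sub>M ?B). snd y \<le> snd (fst y)} =
        (SIGMA x:space (M \<Otimes>\<^sub>M unit_interval). {0..snd x})"
      by (auto simp: space_pair_measure space_restrict_space)
    finally show ?thesis .
  qed
  have ker: "(\<lambda>x. measure (H (p + fst x *\<^sub>R e)) {0..snd x}) \<in> borel_measurable (M \<Otimes>\<^sub>M unit_interval)"
    if "cont_S H" for H
    by (rule measure_measurable_subprob_algebra2[OF Sig])
      (rule measurable_compose[OF measurable_compose[OF measurable_fst shift_measurable[OF M e p]] cont_S_kernel[OF that]])
  have int: "integrable (M \<Otimes>\<^sub>M unit_interval) (case_prod ?g)"
  proof (rule MU.P.integrable_const_bound[where B=1])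
    show "case_prod ?g \<in> borel_measurable (M \<Otimes>\<^sub>M unit_interval)"
      unfolding case_prod_beta using ker[OF G] ker[OF G'] by measurable
    show "AE x in M \<Otimes>\<^sub>M unit_interval. norm (case_prod ?g x) \<le> 1"
    proof (rule AE_I2)
      fix x assume "x \<in> space (M \<Otimes>\<^sub>M unit_interval)"
      then have x: "fst x \<in> space M" by (auto simp: space_pair_measure)
      show "norm (case_prod ?g x) \<le> 1"
        using Prob_on_measure_diff_le_1[OF cont_SD[OF G shS[OF x]] cont_SD[OF G' shS[OF x]]]
        by (simp add: case_prod_beta)
    qed
  qed
  show "integrable unit_interval F"
    unfolding F_def avg_def using MU.integrable_snd[OF int] .
  have "(\<integral>t. F t \<partial>unit_interval) = (\<integral>k. (\<integral>t. ?g k t \<partial>unit_interval) \<partial>M)"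
    unfolding F_def avg_def by (rule MU.Fubini_integral[OF int])
  also have "\<dots> = avg M e (\<lambda>q. dW (G q) (G' q)) p"
    unfolding avg_def
    by (intro Bochner_Integration.integral_cong refl dW_eq[symmetric] cont_SD[OF G] cont_SD[OF G'] shS)
  finally show "(\<integral>t. F t \<partial>unit_interval) = avg M e (\<lambda>q. dW (G q) (G' q)) p" .
qed

text \<open>The setwise average of a kernel is the bind of the increment law with that
  kernel.\<close>

lemma avg_measure:
  assumes M: "M \<in> Prob_on 0 \<beta>" and e: "fst e \<ge> 0" "snd e \<ge> 0" and p: "p \<in> S_set" and G: "cont_S G"
  shows "\<exists>L\<in>Prob_on 0 1. \<forall>A\<in>sets (restrict_space borel {0..1}). measure L A = avg M e (\<lambda>q. measure (G q) A) p"
proof -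
  interpret prob_space M using Prob_onD(1)[OF M] .
  let ?K = "\<lambda>k. G (p + k *\<^sub>R e)"
  note shS = shift_bound[OF M e p]
  have K: "?K \<in> measurable M (subprob_algebra (restrict_space borel {0..1}))"
    by (rule measurable_compose[OF shift_measurable[OF M e p] cont_S_kernel[OF G]])
  have "prob_space (M \<bind> ?K)"
    by (rule prob_space_bind[OF AE_I2 K]) (rule Prob_onD(1)[OF cont_SD[OF G shS]])
  moreover have "sets (M \<bind> ?K) = sets (restrict_space borel {0..1})"
    using not_empty by (intro sets_bind cont_S_sets[OF G shS]) auto
  ultimately have "M \<bind> ?K \<in> Prob_on 0 1" by (simp add: Prob_on_def)
  then show ?thesis using measure_bind[OF K] by (auto simp: avg_def)
qed

section \<open>Harmonic measure-valued maps\<close>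

context urn
begin

definition harmonic :: "(real \<times> real \<Rightarrow> real measure) \<Rightarrow> bool" where
  "harmonic G \<longleftrightarrow> (\<forall>p\<in>S_set. \<forall>A\<in>sets (restrict_space borel {0..1}).
     measure (G p) A = step (\<lambda>q. measure (G q) A) p)"

text \<open>Realising the setwise average as a probability measure makes it comparable in
  \<open>dW\<close>, which the limit argument needs before harmonicity is known. It is the mixture
  of the two colour averages.\<close>

lemma step_measure:
  assumes G: "cont_S G" and p: "p \<in> S_set"
  shows "\<exists>L\<in>Prob_on 0 1. \<forall>A\<in>sets (restrict_space borel {0..1}).
    measure L A = step (\<lambda>q. measure (G q) A) p"
proof -
  obtain L1 where L1: "L1 \<in> Prob_on 0 1" "\<And>A. A \<in> sets (restrict_space borel {0..1}) \<Longrightarrow>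
      measure L1 A = avg \<mu> (1, 0) (\<lambda>q. measure (G q) A) p"
    using avg_measure[OF mu _ _ p G, of "(1,0)"] by auto
  obtain L2 where L2: "L2 \<in> Prob_on 0 1" "\<And>A. A \<in> sets (restrict_space borel {0..1}) \<Longrightarrow>
      measure L2 A = avg \<nu> (0, 1) (\<lambda>q. measure (G q) A) p"
    using avg_measure[OF nu _ _ p G, of "(0,1)"] by auto
  have s: "fst p + snd p > 0" "fst p \<ge> 0" "snd p \<ge> 0" using p by (auto simp: S_set_iff)
  let ?w = "\<lambda>k::nat. (if k = 0 then fst p else snd p) / (fst p + snd p)"
  have "\<exists>M\<in>Prob_on 0 1. \<forall>A\<in>sets (restrict_space borel {0..1}).
      measure M A = (\<Sum>k\<le>1. ?w k * measure (if k = 0 then L1 else L2) A)"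
    using L1 L2 s by (intro Prob_on_mixture) (auto simp: add_divide_distrib[symmetric])
  then show ?thesis
    using L1(2) L2(2) by (simp add: step_def add_divide_distrib)
qed

text \<open>For each \<open>t\<close>, positivity bounds the absolute value of an averaged
  difference by the averaged absolute difference; integrating over \<open>t\<close> gives the claim.
  For \<open>L = G p\<close> and \<open>L' = G' p\<close> with harmonic maps this is subharmonicity
  of the distance; general \<open>L\<close> and \<open>L'\<close> serve for limits.\<close>

lemma dW_step_le:
  assumes G: "cont_S G" and G': "cont_S G'" and p: "p \<in> S_set"
    and L: "L \<in> Prob_on 0 1" "L' \<in> Prob_on 0 1"
    and eq: "\<And>t. t \<in> {0..1} \<Longrightarrow> measure L {0..t} = step (\<lambda>q. measure (G q) {0..t}) p"
      "\<And>t. t \<in> {0..1} \<Longrightarrow> measure L' {0..t} = step (\<lambda>q. measure (G' q) {0..t}) p"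
  shows "dW L L' \<le> step (\<lambda>q. dW (G q) (G' q)) p"
proof -
  let ?F = "\<lambda>t q. \<bar>measure (G q) {0..t} - measure (G' q) {0..t}\<bar>"
  have I1: "integrable unit_interval (\<lambda>t. avg \<mu> (1, 0) (?F t) p)"
      "(\<integral>t. avg \<mu> (1, 0) (?F t) p \<partial>unit_interval) = avg \<mu> (1, 0) (\<lambda>q. dW (G q) (G' q)) p"
    using avg_dW[OF mu _ _ p G G', of "(1,0)"] by auto
  have I2: "integrable unit_interval (\<lambda>t. avg \<nu> (0, 1) (?F t) p)"
      "(\<integral>t. avg \<nu> (0, 1) (?F t) p \<partial>unit_interval) = avg \<nu> (0, 1) (\<lambda>q. dW (G q) (G' q)) p"
    using avg_dW[OF nu _ _ p G G', of "(0,1)"] by auto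
  have "dW L L' \<le> (\<integral>t. step (?F t) p \<partial>unit_interval)"
  proof (intro dW_le L)
    show "integrable unit_interval (\<lambda>t. step (?F t) p)"
      unfolding step_def using I1(1) I2(1) by auto
    fix t :: real assume t: "t \<in> {0..1}"
    then have S: "{0..t} \<in> sets (restrict_space borel {0..1})" by (intro unit_Icc_sets) auto
    note b = cont_S_bm[OF G S] cont_S_bm[OF G' S]
    have d: "measure L {0..t} - measure L' {0..t} = step (\<lambda>q. measure (G q) {0..t} - measure (G' q) {0..t}) p"
      unfolding eq[OF t] by (rule step_diff[OF b p, symmetric])
    have "step (\<lambda>q. measure (G q) {0..t} - measure (G' q) {0..t}) p \<le> step (?F t) p"
      by (intro step_mono bm_diff bm_abs b p) simp
    moreover have "step (\<lambda>q. (-1) * (measure (G q) {0..t} - measure (G' q) {0..t})) p \<le> step (?F t) p"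
      by (intro step_mono bm_diff bm_cmult bm_abs b p) simp
    ultimately show "\<bar>measure L {0..t} - measure L' {0..t}\<bar> \<le> step (?F t) p"
      unfolding step_cmult[of "-1"] d by (intro abs_leI) auto
  qed
  also have "\<dots> = step (\<lambda>q. dW (G q) (G' q)) p"
    unfolding step_def using I1 I2 by simp
  finally show ?thesis .
qed

lemma harmonic_comparison:
  assumes G: "cont_S G" "harmonic G" and G': "cont_S G'" "harmonic G'"
    and inf: "\<And>e. e > 0 \<Longrightarrow> \<exists>R. \<forall>p\<in>S_set. fst p + snd p \<ge> R \<longrightarrow> dW (G p) (G' p) \<le> c + e"
    and p: "p \<in> S_set"
  shows "dW (G p) (G' p) \<le> c"
proof (rule max_principle[OF cont_S_dW_bc[OF G(1) G'(1)] _ inf p])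
  fix p assume p: "p \<in> S_set"
  show "dW (G p) (G' p) \<le> step (\<lambda>q. dW (G q) (G' q)) p"
    using G(2) G'(2) p
    by (intro dW_step_le G G' p cont_SD[OF G(1)] cont_SD[OF G'(1)]) (auto simp: harmonic_def unit_Icc_sets)
qed

lemma inv_total_le:
  assumes "K \<ge> 0" "e > 0" "p \<in> S_set" "fst p + snd p \<ge> K / e"
  shows "K * inv_total p \<le> e"
proof -
  have "K \<le> e * (fst p + snd p)" using assms by (simp add: divide_le_eq mult.commute)
  also have "\<dots> \<le> e * (1 + (fst p + snd p))" using assms by simp
  finally show ?thesis using assms by (simp add: inv_total_def S_set_iff divide_le_eq)
qed

lemma inv_total_nonneg: "p \<in> S_set \<Longrightarrow> 0 \<le> inv_total p"
  by (simp add: inv_total_def S_set_iff)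

text \<open>An error that vanishes at infinity disappears altogether for harmonic functions. This
  turns approximate signs and sums of the harmonic weights into exact ones.\<close>

lemma harmonic_function_le:
  assumes g: "bc g" "\<And>p. p \<in> S_set \<Longrightarrow> step g p = g p" and K: "K \<ge> 0"
    and le: "\<And>p. p \<in> S_set \<Longrightarrow> g p \<le> c + K * inv_total p" and p: "p \<in> S_set"
  shows "g p \<le> c"
proof (rule max_principle[OF g(1) _ _ p])
  show "\<exists>R. \<forall>p\<in>S_set. fst p + snd p \<ge> R \<longrightarrow> g p \<le> c + e" if "e > 0" for e
    using inv_total_le[OF K that] le by (intro exI[of _ "K / e"]) fastforce
qed (simp add: g)

section \<open>Boundary data and their Bernstein approximation\<close>

lemma boundary_datumD: "boundary_datum \<phi> \<Longrightarrow> t \<in> {0..1} \<Longrightarrow> \<phi> t \<in> Prob_on 0 1"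
  by (simp add: boundary_datum_def)

text \<open>Heine-Cantor for the real function
  \<open>(s, t) \<mapsto> dW (\<phi> s) (\<phi> t)\<close> on the compact square, compared with its
  zero values on the diagonal.\<close>

lemma boundary_datum_uniform:
  assumes \<phi>: "boundary_datum \<phi>" and e: "e > 0"
  obtains d where "d > 0" "\<And>s t. s \<in> {0..1} \<Longrightarrow> t \<in> {0..1} \<Longrightarrow> \<bar>s - t\<bar> < d \<Longrightarrow> dW (\<phi> s) (\<phi> t) < e"
proof -
  let ?g = "\<lambda>x. dW (\<phi> (fst x)) (\<phi> (snd x))"
  let ?Q = "{0..1::real} \<times> {0..1::real}"
  note P = boundary_datumD[OF \<phi>]
  have "continuous_on ?Q ?g"
    unfolding continuous_on_iff
  proof (intro ballI allI impI)
    fix x :: "real \<times> real" and e :: real assume x: "x \<in> ?Q" and e: "e > 0"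
    then have e2: "e / 2 > 0" by simp
    have x': "fst x \<in> {0..1}" "snd x \<in> {0..1}" using x by auto
    obtain d1 where d1: "d1 > 0" "\<And>s. s \<in> {0..1} \<Longrightarrow> \<bar>s - fst x\<bar> < d1 \<Longrightarrow> dW (\<phi> s) (\<phi> (fst x)) < e / 2"
      using \<phi> x'(1) e2 unfolding boundary_datum_def by blast
    obtain d2 where d2: "d2 > 0" "\<And>s. s \<in> {0..1} \<Longrightarrow> \<bar>s - snd x\<bar> < d2 \<Longrightarrow> dW (\<phi> s) (\<phi> (snd x)) < e / 2"
      using \<phi> x'(2) e2 unfolding boundary_datum_def by blast
    have "dist (?g y) (?g x) < e" if y: "y \<in> ?Q" "dist y x < min d1 d2" for y
    proof -
      have y': "fst y \<in> {0..1}" "snd y \<in> {0..1}" using y by auto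
      have "\<bar>fst y - fst x\<bar> < d1" "\<bar>snd y - snd x\<bar> < d2"
        using y(2) dist_fst_le[of y x] dist_snd_le[of y x] by (auto simp: dist_real_def)
      then show ?thesis
        using dW_abs_diff[OF P P P P, OF y' x'] d1(2)[OF y'(1)] d2(2)[OF y'(2)] by (simp add: dist_real_def)
    qed
    then show "\<exists>d>0. \<forall>y\<in>?Q. dist y x < d \<longrightarrow> dist (?g y) (?g x) < e"
      using d1(1) d2(1) by (intro exI[of _ "min d1 d2"]) auto
  qed
  then have "uniformly_continuous_on ?Q ?g"
    by (intro compact_uniformly_continuous compact_Times) auto
  then obtain d where d: "d > 0" "\<And>x y. x \<in> ?Q \<Longrightarrow> y \<in> ?Q \<Longrightarrow> dist y x < d \<Longrightarrow> dist (?g y) (?g x) < e"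
    using e unfolding uniformly_continuous_on_def by blast
  show thesis
  proof (rule that[OF d(1)])
    fix s t :: real assume st: "s \<in> {0..1}" "t \<in> {0..1}" "\<bar>s - t\<bar> < d"
    have "dist (s, t) (t, t) < d" using st by (simp add: dist_Pair_Pair dist_real_def)
    then have "dist (?g (s, t)) (?g (t, t)) < e" using st by (intro d(2)) auto
    then show "dW (\<phi> s) (\<phi> t) < e" by (simp add: dW_refl dist_real_def)
  qed
qed

text \<open>The variance of a binomial proportion; the square is split into the factorial moments
  \<open>k * (k - 1)\<close> and \<open>k\<close>, whose Bernstein sums are known.\<close>

lemma Bernstein_variance:
  assumes "n > 0"
  shows "(\<Sum>k\<le>n. Bernstein n k z * (real k / real n - z)\<^sup>2) = z * (1 - z) / real n"
proof -
  have "(real k / real n - z)\<^sup>2 =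
      (real k * (real k - 1) + (1 - 2 * real n * z) * real k + (real n * z)\<^sup>2) / (real n)\<^sup>2" for k
    using assms by (simp add: field_simps power2_eq_square)
  then have "(\<Sum>k\<le>n. Bernstein n k z * (real k / real n - z)\<^sup>2) =
      (\<Sum>k\<le>n. (real k * (real k - 1) * Bernstein n k z + (1 - 2 * real n * z) * (real k * Bernstein n k z)
        + (real n * z)\<^sup>2 * Bernstein n k z) / (real n)\<^sup>2)"
    by (intro sum.cong) (auto simp: field_simps)
  also have "\<dots> = (real n * (real n - 1) * z\<^sup>2 + (1 - 2 * real n * z) * (real n * z) + (real n * z)\<^sup>2) / (real n)\<^sup>2"
    by (simp only: sum_divide_distrib[symmetric] sum.distrib sum_distrib_left[symmetric]
        sum_kk_Bernstein sum_k_Bernstein sum_Bernstein mult_1_right)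
  also have "\<dots> = z * (1 - z) / real n"
    using assms by (simp add: field_simps power2_eq_square)
  finally show ?thesis .
qed

text \<open>Uniform continuity controls the nodes near \<open>z\<close>; at the remaining nodes the
  distance is at most 1, and Chebyshev's inequality bounds their weight.\<close>

lemma Bernstein_approx:
  assumes \<phi>: "boundary_datum \<phi>" and e: "e > 0"
  obtains n where "n > 0" "\<And>z. z \<in> {0..1} \<Longrightarrow>
    (\<Sum>k\<le>n. Bernstein n k z * dW (\<phi> (real k / real n)) (\<phi> z)) \<le> e"
proof -
  have "e / 2 > 0" using e by simp
  then obtain d where d: "d > 0" "\<And>s t. s \<in> {0..1} \<Longrightarrow> t \<in> {0..1} \<Longrightarrow> \<bar>s - t\<bar> < d \<Longrightarrow> dW (\<phi> s) (\<phi> t) < e / 2"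
    using boundary_datum_uniform[OF \<phi>] by metis
  \<comment> \<open>The threshold makes the Chebyshev term \<open>1 / real n / d\<^sup>2\<close> at
    most \<open>e / 2\<close>.\<close>
  obtain n0 :: nat where n0: "2 / (e * d\<^sup>2) < real n0" using reals_Archimedean2 by blast
  define n where "n = Suc n0"
  have n: "n > 0" "2 / (e * d\<^sup>2) \<le> real n" using n0 by (auto simp: n_def)
  show thesis
  proof (rule that[OF n(1)])
    fix z :: real assume z: "z \<in> {0..1}"
    have "(\<Sum>k\<le>n. Bernstein n k z * dW (\<phi> (real k / real n)) (\<phi> z)) \<le>
        (\<Sum>k\<le>n. Bernstein n k z * (e / 2 + (real k / real n - z)\<^sup>2 / d\<^sup>2))"
    proof (intro sum_mono mult_left_mono)
      fix k assume "k \<in> {..n}"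
      then have k: "real k / real n \<in> {0..1}" using n by simp
      show "dW (\<phi> (real k / real n)) (\<phi> z) \<le> e / 2 + (real k / real n - z)\<^sup>2 / d\<^sup>2"
      proof (cases "\<bar>real k / real n - z\<bar> < d")
        case True
        then show ?thesis using d(2)[OF k z] by (intro add_increasing2) auto
      next
        case False
        then have "d\<^sup>2 \<le> \<bar>real k / real n - z\<bar>\<^sup>2" using d(1) by (intro power_mono) auto
        then have "1 \<le> (real k / real n - z)\<^sup>2 / d\<^sup>2" using d(1) by simp
        moreover have "dW (\<phi> (real k / real n)) (\<phi> z) \<le> 1"
          by (intro dW_le_1 boundary_datumD[OF \<phi>] k z)
        ultimately show ?thesis using e by linarith
      qed
      show "0 \<le> Bernstein n k z" using z by (intro Bernstein_nonneg) auto
    qed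
    also have "\<dots> = e / 2 * (\<Sum>k\<le>n. Bernstein n k z) + (\<Sum>k\<le>n. Bernstein n k z * (real k / real n - z)\<^sup>2) / d\<^sup>2"
      unfolding sum_distrib_left sum_divide_distrib sum.distrib[symmetric]
      by (intro sum.cong) (auto simp: algebra_simps)
    also have "\<dots> = e / 2 + z * (1 - z) / real n / d\<^sup>2"
      by (simp only: sum_Bernstein Bernstein_variance[OF n(1)] mult_1_right)
    also have "\<dots> \<le> e / 2 + 1 / real n / d\<^sup>2"
      using z by (intro add_left_mono divide_right_mono mult_le_one) auto
    also have "\<dots> \<le> e"
      using n d(1) e by (simp add: field_simps)
    finally show "(\<Sum>k\<le>n. Bernstein n k z * dW (\<phi> (real k / real n)) (\<phi> z)) \<le> e" .
  qed
qed

section \<open>Existence: harmonic mixtures of boundary values and their limit\<close>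

lemma approximate_solution:
  assumes \<phi>: "boundary_datum \<phi>" and e: "e > 0"
  shows "\<exists>G. cont_S G \<and> harmonic G \<and> (\<forall>y>0. G (0, y) = \<phi> 0) \<and> (\<forall>x>0. G (x, 0) = \<phi> 1)
    \<and> (\<exists>K\<ge>0. \<forall>p\<in>S_set. dW (G p) (\<phi> (proportion p)) \<le> e + K * inv_total p)"
proof -
  let ?B = "restrict_space borel {0..1::real}"
  obtain n where n: "n > 0" and appr: "\<And>z. z \<in> {0..1} \<Longrightarrow>
      (\<Sum>k\<le>n. Bernstein n k z * dW (\<phi> (real k / real n)) (\<phi> z)) \<le> e"
    using Bernstein_approx[OF \<phi> e] by metis
  define N where "N k = \<phi> (real k / real n)" for k :: nat
  have N: "N k \<in> Prob_on 0 1" if "k \<le> n" for k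
    unfolding N_def using that n by (intro boundary_datumD[OF \<phi>]) auto
  have "\<forall>k. \<exists>h K. bc h \<and> K \<ge> 0 \<and> (\<forall>p\<in>S_set. step h p = h p)
    \<and> (\<forall>p\<in>S_set. \<bar>h p - Bernstein n k (proportion p)\<bar> \<le> K * inv_total p)
    \<and> (\<forall>y>0. h (0, y) = Bernstein n k 0) \<and> (\<forall>x>0. h (x, 0) = Bernstein n k 1)"
    using harmonic_Bernstein by blast
  then obtain h K where h: "\<And>k. bc (h k)" and K: "\<And>k. K k \<ge> 0"
    and hstep: "\<And>k p. p \<in> S_set \<Longrightarrow> step (h k) p = h k p"
    and hB: "\<And>k p. p \<in> S_set \<Longrightarrow> \<bar>h k p - Bernstein n k (proportion p)\<bar> \<le> K k * inv_total p"
    and h0: "\<And>k y. y > 0 \<Longrightarrow> h k (0, y) = Bernstein n k 0"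
    and h1: "\<And>k x. x > 0 \<Longrightarrow> h k (x, 0) = Bernstein n k 1"
    by metis
  note hm = bc_imp_bm[OF h]
  define KK where "KK = (\<Sum>k\<le>n. K k)"
  have KK: "KK \<ge> 0" unfolding KK_def by (intro sum_nonneg K)
  have Bnn: "0 \<le> Bernstein n k (proportion p)" if "p \<in> S_set" for k p
    using proportion_range[OF that] by (intro Bernstein_nonneg) auto
  \<comment> \<open>Bernstein polynomials are nonnegative on the unit interval, so the negative of a
    weight is at most a term vanishing at infinity.\<close>
  have h_nonneg: "0 \<le> h k p" if p: "p \<in> S_set" for k p
  proof -
    have "(-1) * h k p \<le> 0"
    proof (rule harmonic_function_le[OF _ _ K _ p])
      show "bc (\<lambda>p. (-1) * h k p)" using bc_diff[OF bc_const[of 0] h[of k]] by simp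
      show "step (\<lambda>p. (-1) * h k p) p = (-1) * h k p" if "p \<in> S_set" for p
        unfolding step_cmult hstep[OF that] ..
      show "(-1) * h k p \<le> 0 + K k * inv_total p" if "p \<in> S_set" for p
        using hB[OF that, of k] Bnn[OF that, of k] by linarith
    qed
    then show ?thesis by simp
  qed
  have sum_err: "\<bar>(\<Sum>k\<le>n. h k p) - 1\<bar> \<le> KK * inv_total p" if p: "p \<in> S_set" for p
  proof -
    have "(\<Sum>k\<le>n. h k p) - 1 = (\<Sum>k\<le>n. h k p - Bernstein n k (proportion p))"
      by (simp add: sum_subtractf)
    also have "\<bar>\<dots>\<bar> \<le> (\<Sum>k\<le>n. \<bar>h k p - Bernstein n k (proportion p)\<bar>)" by (rule sum_abs)
    also have "\<dots> \<le> (\<Sum>k\<le>n. K k * inv_total p)" by (intro sum_mono hB p)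
    finally show ?thesis by (simp add: KK_def sum_distrib_right)
  qed
  have sum_step: "step (\<lambda>p. \<Sum>k\<le>n. h k p) p = (\<Sum>k\<le>n. h k p)" if "p \<in> S_set" for p
    using that by (subst step_sum) (auto simp: hm hstep)
  \<comment> \<open>The sum is harmonic and tends to 1 at infinity, since the Bernstein polynomials
    sum to 1; the maximum principle from above and from below forces equality.\<close>
  have h_sum: "(\<Sum>k\<le>n. h k p) = 1" if p: "p \<in> S_set" for p
  proof (rule antisym)
    have le: "(\<Sum>k\<le>n. h k p) \<le> 1 + KK * inv_total p" if "p \<in> S_set" for p
      using sum_err[OF that] by linarith
    show "(\<Sum>k\<le>n. h k p) \<le> 1"
      by (rule harmonic_function_le[OF bc_sum[OF h] sum_step KK le p])
    have "(-1) * (\<Sum>k\<le>n. h k p) \<le> -1"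
    proof (rule harmonic_function_le[OF _ _ KK _ p])
      show "bc (\<lambda>p. (-1) * (\<Sum>k\<le>n. h k p))" using bc_diff[OF bc_const[of 0] bc_sum[OF h]] by simp
      show "step (\<lambda>p. (-1) * (\<Sum>k\<le>n. h k p)) p = (-1) * (\<Sum>k\<le>n. h k p)" if "p \<in> S_set" for p
        unfolding step_cmult sum_step[OF that] ..
      show "(-1) * (\<Sum>k\<le>n. h k p) \<le> -1 + KK * inv_total p" if "p \<in> S_set" for p
        using sum_err[OF that] by linarith
    qed
    then show "1 \<le> (\<Sum>k\<le>n. h k p)" by simp
  qed
  have "\<forall>p\<in>S_set. \<exists>M\<in>Prob_on 0 1. \<forall>A\<in>sets ?B. measure M A = (\<Sum>k\<le>n. h k p * measure (N k) A)"
    using h_nonneg h_sum N by (intro ballI Prob_on_mixture) auto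
  then obtain G where G: "\<And>p. p \<in> S_set \<Longrightarrow> G p \<in> Prob_on 0 1"
    and GA: "\<And>p A. p \<in> S_set \<Longrightarrow> A \<in> sets ?B \<Longrightarrow> measure (G p) A = (\<Sum>k\<le>n. h k p * measure (N k) A)"
    by metis
  have Gt: "measure (G p) {0..t} = (\<Sum>k\<le>n. h k p * measure (N k) {0..t})"
    if "p \<in> S_set" "t \<in> {0..1}" for p t
    using that by (intro GA unit_Icc_sets) auto
  have cont: "cont_S G"
    unfolding cont_S_def
  proof (intro conjI ballI allI impI G)
    fix p :: "real \<times> real" and e :: real assume p: "p \<in> S_set" and e: "e > 0"
    have "continuous_on S_set (\<lambda>q. \<Sum>k\<le>n. \<bar>h k q - h k p\<bar>)"
      using h by (intro continuous_intros) (auto simp: bc_def)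
    then obtain d where d: "d > 0" "\<And>q. q \<in> S_set \<Longrightarrow> dist q p < d \<Longrightarrow>
        dist (\<Sum>k\<le>n. \<bar>h k q - h k p\<bar>) (\<Sum>k\<le>n. \<bar>h k p - h k p\<bar>) < e"
      using p e unfolding continuous_on_iff by blast
    have "dW (G q) (G p) < e" if q: "q \<in> S_set" "dist q p < d" for q
    proof -
      have "dW (G q) (G p) \<le> (\<Sum>k\<le>n. \<bar>h k q - h k p\<bar>)"
        by (intro dW_mixtures_le[where N=N] G N Gt p q)
      also have "\<dots> < e" using d(2)[OF q] by (simp add: dist_real_def)
      finally show ?thesis .
    qed
    then show "\<exists>d>0. \<forall>q\<in>S_set. dist q p < d \<longrightarrow> dW (G q) (G p) < e" using d(1) by blast
  qed
  have harm: "harmonic G"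
    unfolding harmonic_def
  proof (intro ballI)
    fix p A assume p: "p \<in> S_set" and A: "A \<in> sets ?B"
    have "step (\<lambda>q. measure (G q) A) p = step (\<lambda>q. \<Sum>k\<le>n. measure (N k) A * h k q) p"
      using GA[OF _ A] by (intro step_cong p) (simp add: mult.commute)
    also have "\<dots> = (\<Sum>k\<le>n. measure (N k) A * step (h k) p)"
      using p by (subst step_sum) (auto simp: step_cmult intro: bm_cmult hm)
    also have "\<dots> = measure (G p) A" using GA[OF p A] hstep[OF p] by (simp add: mult.commute)
    finally show "measure (G p) A = step (\<lambda>q. measure (G q) A) p" ..
  qed
  \<comment> \<open>At 0 only the Bernstein polynomial of index 0 is nonzero, at 1 only that of
    index \<open>n\<close>, so on an edge the mixture collapses to one component.\<close>
  have edge: "G p = N j" if p: "p \<in> S_set" and j: "j \<le> n"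
    and hj: "\<And>k. k \<le> n \<Longrightarrow> h k p = (if k = j then 1 else 0)" for p j
  proof (rule Prob_on_eqI[OF G[OF p] N[OF j]])
    fix t :: real assume "0 \<le> t" "t < 1"
    then have "measure (G p) {0..t} = (\<Sum>k\<le>n. (if k = j then 1 else 0) * measure (N k) {0..t})"
      using Gt[OF p, of t] hj by simp
    also have "\<dots> = measure (N j) {0..t}"
      using j by (subst sum.remove[of _ j]) auto
    finally show "measure (G p) {0..t} = measure (N j) {0..t}" .
  qed
  have "G (0, y) = \<phi> 0" if "y > 0" for y
    using edge[of "(0, y)" 0] h0[OF that] that by (simp add: N_def S_set_iff Bernstein_def)
  moreover have "G (x, 0) = \<phi> 1" if "x > 0" for x
    using edge[of "(x, 0)" n] h1[OF that] that n by (simp add: N_def S_set_iff Bernstein_def)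
  moreover have "dW (G p) (\<phi> (proportion p)) \<le> e + KK * inv_total p" if p: "p \<in> S_set" for p
  proof -
    have z: "proportion p \<in> {0..1}" by (rule proportion_range[OF p])
    have Pz: "\<phi> (proportion p) \<in> Prob_on 0 1" by (rule boundary_datumD[OF \<phi> z])
    have "dW (G p) (\<phi> (proportion p)) \<le> (\<Sum>k\<le>n. h k p * dW (N k) (\<phi> (proportion p)))"
      by (intro dW_mixture_le G p Pz N h_nonneg h_sum Gt)
    \<comment> \<open>Replacing each weight by its Bernstein polynomial costs at most
      \<open>K k * inv_total p\<close>, as the distances lie between 0 and 1.\<close>
    also have "\<dots> \<le> (\<Sum>k\<le>n. Bernstein n k (proportion p) * dW (N k) (\<phi> (proportion p)) + K k * inv_total p)"
    proof (intro sum_mono)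
      fix k assume "k \<in> {..n}"
      then have D: "0 \<le> dW (N k) (\<phi> (proportion p))" "dW (N k) (\<phi> (proportion p)) \<le> 1"
        using dW_nonneg[OF N Pz] dW_le_1[OF N Pz] by auto
      have "(h k p - Bernstein n k (proportion p)) * dW (N k) (\<phi> (proportion p)) \<le> (K k * inv_total p) * 1"
        using hB[OF p, of k] D K inv_total_nonneg[OF p] by (intro mult_mono) auto
      then show "h k p * dW (N k) (\<phi> (proportion p)) \<le>
          Bernstein n k (proportion p) * dW (N k) (\<phi> (proportion p)) + K k * inv_total p"
        by (simp add: algebra_simps)
    qed
    also have "\<dots> \<le> e + KK * inv_total p"
      using appr[OF z] by (simp add: sum.distrib KK_def sum_distrib_right N_def)
    finally show ?thesis .
  qed
  ultimately show ?thesis using cont harm KK by blast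
qed

text \<open>Masses of fixed sets do not pass to the limit in \<open>dW\<close>, so harmonicity is
  not obtained setwise. Instead \<open>L p\<close> is compared in distance with the averaged measure
  \<open>M\<close>: both lie within \<open>d n\<close> of \<open>G n p\<close>, and hence they
  coincide.\<close>

lemma harmonic_limit:
  assumes G: "\<And>n. cont_S (G n)" "\<And>n. harmonic (G n)" and d: "d \<longlonglongrightarrow> 0"
    and L: "\<And>p. p \<in> S_set \<Longrightarrow> L p \<in> Prob_on 0 1"
    and lim: "\<And>n p. p \<in> S_set \<Longrightarrow> dW (G n p) (L p) \<le> d n"
  shows "cont_S L" "harmonic L"
proof -
  have small: "\<exists>n. d n < e" if "e > 0" for e
  proof -
    have "\<forall>\<^sub>F n in sequentially. d n < e" using that by (intro order_tendstoD(2)[OF d])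
    then show ?thesis by (auto simp: eventually_sequentially)
  qed
  show cont: "cont_S L"
    unfolding cont_S_def
  proof (intro conjI ballI allI impI L)
    fix p :: "real \<times> real" and e :: real assume p: "p \<in> S_set" and e: "e > 0"
    then have e3: "e / 3 > 0" by simp
    then obtain n where n: "d n < e / 3" using small by blast
    obtain r where r: "r > 0" "\<And>q. q \<in> S_set \<Longrightarrow> dist q p < r \<Longrightarrow> dW (G n q) (G n p) < e / 3"
      using G(1)[of n] p e3 unfolding cont_S_def by blast
    have "dW (L q) (L p) < e" if q: "q \<in> S_set" "dist q p < r" for q
    proof -
      have "dW (L q) (L p) \<le> dW (L q) (G n q) + dW (G n q) (L p)"
        by (intro dW_triangle L cont_SD[OF G(1)] p q)
      moreover have "dW (G n q) (L p) \<le> dW (G n q) (G n p) + dW (G n p) (L p)"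
        by (intro dW_triangle L cont_SD[OF G(1)] p q)
      ultimately show ?thesis
        using r(2)[OF q] lim[OF p, of n] lim[OF q(1), of n] n dW_commute[of "L q"] by simp
    qed
    then show "\<exists>r>0. \<forall>q\<in>S_set. dist q p < r \<longrightarrow> dW (L q) (L p) < e" using r(1) by blast
  qed
  show "harmonic L"
    unfolding harmonic_def
  proof (rule ballI)
    fix p assume p: "p \<in> S_set"
    obtain M where M: "M \<in> Prob_on 0 1" and MA: "\<And>A. A \<in> sets (restrict_space borel {0..1}) \<Longrightarrow>
        measure M A = step (\<lambda>q. measure (L q) A) p"
      using step_measure[OF cont p] by blast
    have le: "dW (L p) M \<le> 2 * d n" for n
    proof -
      have "dW (G n p) M \<le> step (\<lambda>q. dW (G n q) (L q)) p"
        using G(2)[of n] p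
        by (intro dW_step_le G cont p cont_SD[OF G(1)] M) (auto simp: harmonic_def unit_Icc_sets MA)
      also have "\<dots> \<le> step (\<lambda>_. d n) p"
        by (intro step_mono bm_const bc_imp_bm cont_S_dW_bc G cont p lim)
      also have "\<dots> = d n" by (rule step_const[OF p])
      finally show ?thesis
        using dW_triangle[OF L[OF p] cont_SD[OF G(1) p] M, of n] lim[OF p, of n]
        by (simp add: dW_commute[of "L p"])
    qed
    have "(\<lambda>n. 2 * d n) \<longlonglongrightarrow> 2 * 0" by (intro tendsto_intros d)
    then have "dW (L p) M \<le> 2 * 0" by (rule LIMSEQ_le_const) (use le in auto)
    then have "dW (L p) M = 0" using dW_nonneg[OF L[OF p] M] by simp
    then have "L p = M" by (rule dW_eq_0D[OF L[OF p] M])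
    then show "\<forall>A\<in>sets (restrict_space borel {0..1}). measure (L p) A = step (\<lambda>q. measure (L q) A) p"
      using MA by simp
  qed
qed

lemma solution_exists:
  assumes \<phi>: "boundary_datum \<phi>"
  shows "\<exists>G. cont_S G \<and> harmonic G \<and> (\<forall>y>0. G (0, y) = \<phi> 0) \<and> (\<forall>x>0. G (x, 0) = \<phi> 1)
    \<and> (\<forall>e>0. \<exists>R. \<forall>p\<in>S_set. fst p + snd p \<ge> R \<longrightarrow> dW (G p) (\<phi> (proportion p)) < e)"
proof -
  define d where "d n = 1 / real (Suc n)" for n
  have d: "d n > 0" for n by (simp add: d_def)
  have dlim: "d \<longlonglongrightarrow> 0" unfolding d_def by (rule LIMSEQ_Suc[OF lim_1_over_n])
  have small: "\<exists>N. \<forall>n\<ge>N. d n < e" if "e > 0" for e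
    using order_tendstoD(2)[OF dlim that] by (simp add: eventually_sequentially)
  obtain G where G: "\<And>n. cont_S (G n)" "\<And>n. harmonic (G n)"
    and G0: "\<And>n y. y > 0 \<Longrightarrow> G n (0, y) = \<phi> 0" and G1: "\<And>n x. x > 0 \<Longrightarrow> G n (x, 0) = \<phi> 1"
    and Ginf: "\<And>n. \<exists>K\<ge>0. \<forall>p\<in>S_set. dW (G n p) (\<phi> (proportion p)) \<le> d n + K * inv_total p"
    using approximate_solution[OF \<phi> d] by metis
  have Pp: "\<phi> (proportion p) \<in> Prob_on 0 1" if "p \<in> S_set" for p
    by (rule boundary_datumD[OF \<phi> proportion_range[OF that]])
  have Ginf': "\<exists>R. \<forall>p\<in>S_set. fst p + snd p \<ge> R \<longrightarrow> dW (G n p) (\<phi> (proportion p)) \<le> d n + e" if "e > 0" for n e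
  proof -
    obtain K where K: "K \<ge> 0" "\<And>p. p \<in> S_set \<Longrightarrow> dW (G n p) (\<phi> (proportion p)) \<le> d n + K * inv_total p"
      using Ginf by blast
    then show ?thesis using inv_total_le[OF K(1) that] by (intro exI[of _ "K / e"]) fastforce
  qed
  \<comment> \<open>At infinity both maps are close to the same boundary value, so the comparison
    principle makes the sequence Cauchy uniformly on the whole quadrant, although completeness is
    used pointwise.\<close>
  have GG: "dW (G n p) (G m p) \<le> d n + d m" if p: "p \<in> S_set" for n m p
  proof (rule harmonic_comparison[OF G G _ p])
    fix e :: real assume "e > 0"
    then have e2: "e / 2 > 0" by simp
    obtain R where R: "\<And>p. p \<in> S_set \<Longrightarrow> fst p + snd p \<ge> R \<Longrightarrow> dW (G n p) (\<phi> (proportion p)) \<le> d n + e / 2"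
      using Ginf'[OF e2] by blast
    obtain R' where R': "\<And>p. p \<in> S_set \<Longrightarrow> fst p + snd p \<ge> R' \<Longrightarrow> dW (G m p) (\<phi> (proportion p)) \<le> d m + e / 2"
      using Ginf'[OF e2] by blast
    have "dW (G n p) (G m p) \<le> d n + d m + e" if p: "p \<in> S_set" "fst p + snd p \<ge> max R R'" for p
      using R[OF p(1)] R'[OF p(1)] p(2) dW_triangle[OF cont_SD[OF G(1) p(1)] Pp[OF p(1)] cont_SD[OF G(1) p(1)], of n m]
        dW_commute[of "G m p"] by simp
    then show "\<exists>R. \<forall>p\<in>S_set. fst p + snd p \<ge> R \<longrightarrow> dW (G n p) (G m p) \<le> d n + d m + e" by blast
  qed
  have "\<forall>p\<in>S_set. \<exists>L\<in>Prob_on 0 1. \<forall>e>0. \<exists>N. \<forall>n\<ge>N. dW (G n p) L \<le> e"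
  proof (intro ballI dW_complete cont_SD[OF G(1)])
    fix p and e :: real assume p: "p \<in> S_set" and "e > 0"
    then obtain N where N: "\<And>n. n \<ge> N \<Longrightarrow> d n < e / 2" using small[of "e / 2"] by auto
    have "dW (G m p) (G n p) < e" if "m \<ge> N" "n \<ge> N" for m n
      using GG[OF p, of m n] N[OF that(1)] N[OF that(2)] by simp
    then show "\<exists>N. \<forall>m\<ge>N. \<forall>n\<ge>N. dW (G m p) (G n p) < e" by blast
  qed
  then obtain L where L: "\<And>p. p \<in> S_set \<Longrightarrow> L p \<in> Prob_on 0 1"
    and Llim: "\<And>p e. p \<in> S_set \<Longrightarrow> e > 0 \<Longrightarrow> \<exists>N. \<forall>n\<ge>N. dW (G n p) (L p) \<le> e"
    by metis
  \<comment> \<open>Letting the second index tend to infinity in \<open>GG\<close> leaves the error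
    \<open>d n\<close>, uniformly in \<open>p\<close>.\<close>
  have GL: "dW (G n p) (L p) \<le> d n" if p: "p \<in> S_set" for n p
  proof (rule field_le_epsilon)
    fix e :: real assume "e > 0"
    then have e2: "e / 2 > 0" by simp
    obtain N where N: "\<And>m. m \<ge> N \<Longrightarrow> dW (G m p) (L p) \<le> e / 2" using Llim[OF p e2] by blast
    obtain N' where N': "\<And>m. m \<ge> N' \<Longrightarrow> d m < e / 2" using small[OF e2] by blast
    define m where "m = max N N'"
    show "dW (G n p) (L p) \<le> d n + e"
      using GG[OF p, of n m] N[of m] N'[of m] dW_triangle[OF cont_SD[OF G(1) p] cont_SD[OF G(1) p] L[OF p], of n m]
      by (simp add: m_def)
  qed
  \<comment> \<open>On an edge all approximations take one and the same value, which the limit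
    inherits exactly.\<close>
  have LG: "L p = M" if p: "p \<in> S_set" and M: "\<And>n. G n p = M" for p M
  proof -
    have MP: "M \<in> Prob_on 0 1" using cont_SD[OF G(1) p] M by metis
    have "dW M (L p) \<le> 0" using GL[OF p] M by (intro LIMSEQ_le_const[OF dlim]) auto
    then have "dW M (L p) = 0" using dW_nonneg[OF MP L[OF p]] by simp
    then show ?thesis using dW_eq_0D[OF MP L[OF p]] by simp
  qed
  have "\<exists>R. \<forall>p\<in>S_set. fst p + snd p \<ge> R \<longrightarrow> dW (L p) (\<phi> (proportion p)) < e" if "e > 0" for e
  proof -
    have e3: "e / 3 > 0" using that by simp
    obtain n where n: "d n < e / 3" using small[OF e3] by blast
    obtain R where R: "\<And>p. p \<in> S_set \<Longrightarrow> fst p + snd p \<ge> R \<Longrightarrow> dW (G n p) (\<phi> (proportion p)) \<le> d n + e / 3"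
      using Ginf'[OF e3] by blast
    have "dW (L p) (\<phi> (proportion p)) < e" if p: "p \<in> S_set" "fst p + snd p \<ge> R" for p
      using R[OF p] GL[OF p(1), of n] n dW_commute[of "L p"]
        dW_triangle[OF L[OF p(1)] cont_SD[OF G(1) p(1)] Pp[OF p(1)], of n] by simp
    then show ?thesis by blast
  qed
  moreover have "L (0, y) = \<phi> 0" if "y > 0" for y
    using that by (intro LG G0) (auto simp: S_set_iff)
  moreover have "L (x, 0) = \<phi> 1" if "x > 0" for x
    using that by (intro LG G1) (auto simp: S_set_iff)
  moreover have "cont_S L" "harmonic L"
    using harmonic_limit[where G=G and d=d and L=L] G dlim L GL by blast+
  ultimately show ?thesis by blast
qed

section \<open>The boundary value problem in terms of harmonicity, and stability of
  solutions\<close>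

lemma functional_equation_iff:
  assumes G: "cont_S G" and p: "(x, y) \<in> S_set" and A: "A \<in> sets (restrict_space borel {0..1})"
  shows "x * (LINT k|\<mu>. measure (G (x, y)) A - measure (G (x + k, y)) A)
      + y * (LINT k|\<nu>. measure (G (x, y)) A - measure (G (x, y + k)) A) = 0 \<longleftrightarrow>
    measure (G (x, y)) A = step (\<lambda>q. measure (G q) A) (x, y)"
proof -
  let ?f = "\<lambda>q. measure (G q) A" and ?c = "measure (G (x, y)) A"
  have "(LINT k|\<mu>. ?c - measure (G (x + k, y)) A) = avg \<mu> (1, 0) (\<lambda>q. ?c - ?f q) (x, y)"
    by (simp add: avg_def)
  also have "\<dots> = ?c - avg \<mu> (1, 0) ?f (x, y)"
    using cont_S_bm[OF G A] p by (subst avg_diff[OF mu]) (auto simp: bm_const avg_const[OF mu])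
  finally have 1: "(LINT k|\<mu>. ?c - measure (G (x + k, y)) A) = ?c - avg \<mu> (1, 0) ?f (x, y)" .
  have "(LINT k|\<nu>. ?c - measure (G (x, y + k)) A) = avg \<nu> (0, 1) (\<lambda>q. ?c - ?f q) (x, y)"
    by (simp add: avg_def)
  also have "\<dots> = ?c - avg \<nu> (0, 1) ?f (x, y)"
    using cont_S_bm[OF G A] p by (subst avg_diff[OF nu]) (auto simp: bm_const avg_const[OF nu])
  finally have 2: "(LINT k|\<nu>. ?c - measure (G (x, y + k)) A) = ?c - avg \<nu> (0, 1) ?f (x, y)" .
  have "x + y > 0" using p by (simp add: S_set_iff)
  then show ?thesis
    unfolding 1 2 step_def by (simp add: field_simps)
qed

lemma is_solution_iff:
  "is_solution \<mu> \<nu> \<phi> G \<longleftrightarrow> cont_S G \<and> harmonic G \<and> (\<forall>y>0. G (0, y) = \<phi> 0) \<and> (\<forall>x>0. G (x, 0) = \<phi> 1)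
    \<and> (\<forall>e>0. \<exists>R. \<forall>p\<in>S_set. fst p + snd p \<ge> R \<longrightarrow> dW (G p) (\<phi> (proportion p)) < e)"
proof (cases "cont_S G")
  case True
  have "(\<forall>(x, y)\<in>S_set. \<forall>A\<in>sets (restrict_space borel {0..1::real}).
        x * (LINT k|\<mu>. measure (G (x, y)) A - measure (G (x + k, y)) A)
      + y * (LINT k|\<nu>. measure (G (x, y)) A - measure (G (x, y + k)) A) = 0) \<longleftrightarrow> harmonic G"
    unfolding harmonic_def using functional_equation_iff[OF True] by (auto simp: case_prod_beta)
  then show ?thesis
    unfolding is_solution_def by (simp add: case_prod_beta proportion_def)
qed (simp add: is_solution_def)

text \<open>The gap of the boundary data bounds the gap of the solutions at infinity, hence
  everywhere. Equal data with \<open>c = 0\<close> give uniqueness; \<open>c\<close> equal to the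
  sup distance of the data gives continuous dependence.\<close>

lemma solutions_dW_le:
  assumes \<phi>: "boundary_datum \<phi>" "boundary_datum \<phi>'"
    and G: "is_solution \<mu> \<nu> \<phi> G" and G': "is_solution \<mu> \<nu> \<phi>' G'"
    and le: "\<And>t. t \<in> {0..1} \<Longrightarrow> dW (\<phi> t) (\<phi>' t) \<le> c" and p: "p \<in> S_set"
  shows "dW (G p) (G' p) \<le> c"
proof (rule harmonic_comparison[OF _ _ _ _ _ p])
  show C: "cont_S G" "harmonic G" "cont_S G'" "harmonic G'" using G G' by (auto simp: is_solution_iff)
  fix e :: real assume "e > 0"
  then have e2: "e / 2 > 0" by simp
  obtain R where R: "\<And>p. p \<in> S_set \<Longrightarrow> fst p + snd p \<ge> R \<Longrightarrow> dW (G p) (\<phi> (proportion p)) < e / 2"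
    using G e2 unfolding is_solution_iff by blast
  obtain R' where R': "\<And>p. p \<in> S_set \<Longrightarrow> fst p + snd p \<ge> R' \<Longrightarrow> dW (G' p) (\<phi>' (proportion p)) < e / 2"
    using G' e2 unfolding is_solution_iff by blast
  have "dW (G p) (G' p) \<le> c + e" if p: "p \<in> S_set" "fst p + snd p \<ge> max R R'" for p
  proof -
    note z = proportion_range[OF p(1)]
    note P = boundary_datumD[OF \<phi>(1) z] boundary_datumD[OF \<phi>(2) z] cont_SD[OF C(1) p(1)] cont_SD[OF C(3) p(1)]
    show ?thesis
      using R[OF p(1)] R'[OF p(1)] p(2) le[OF z] dW_triangle[OF P(3,1,4)] dW_triangle[OF P(1,2,4)]
        dW_commute[of "G' p"] by simp
  qed
  then show "\<exists>R. \<forall>p\<in>S_set. fst p + snd p \<ge> R \<longrightarrow> dW (G p) (G' p) \<le> c + e" by blast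
qed

end

section \<open>Passage to the metrics on boundary data and on solutions\<close>

lemma dW_le_d_infty:
  assumes "boundary_datum \<phi>" "boundary_datum \<phi>'" "t \<in> {0..1}"
  shows "dW (\<phi> t) (\<phi>' t) \<le> d_infty \<phi> \<phi>'"
  unfolding d_infty_def using assms
  by (intro cSUP_upper bdd_aboveI2[of _ _ 1] dW_le_1) (auto simp: boundary_datum_def)

text \<open>Each \<open>d_n\<close> lies between 0 and \<open>c\<close>, the map
  \<open>t / (1 + t)\<close> is at most \<open>t\<close> for nonnegative \<open>t\<close>, and the
  weights sum to 1.\<close>

lemma d_S_le:
  assumes G: "cont_S G" and G': "cont_S G'" and le: "\<And>p. p \<in> S_set \<Longrightarrow> dW (G p) (G' p) \<le> c"
  shows "d_S G G' \<le> c"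
proof -
  have d: "0 \<le> d_n (Suc n) G G'" "d_n (Suc n) G G' \<le> c" for n
  proof -
    let ?S = "{p \<in> S_set. fst p + snd p \<ge> 1 / real (Suc n)}"
    \<comment> \<open>The point \<open>(1, 0)\<close> has total 1, so every supremum is taken over a
      nonempty set and is nonnegative.\<close>
    have ne: "(1, 0) \<in> ?S" by (simp add: S_set_iff)
    show "d_n (Suc n) G G' \<le> c"
      unfolding d_n_def using ne le by (intro cSUP_least) blast+
    have "0 \<le> dW (G (1, 0)) (G' (1, 0))"
      using ne by (intro dW_nonneg cont_SD[OF G] cont_SD[OF G']) auto
    also have "\<dots> \<le> d_n (Suc n) G G'"
      unfolding d_n_def using ne le by (intro cSUP_upper bdd_aboveI2[of _ _ c]) blast+
    finally show "0 \<le> d_n (Suc n) G G'" .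
  qed
  let ?t = "\<lambda>n. (1/2) ^ Suc n * (d_n (Suc n) G G' / (1 + d_n (Suc n) G G'))"
  have bd: "0 \<le> ?t n" "?t n \<le> (1/2) ^ Suc n * c" for n
  proof -
    show "0 \<le> ?t n" using d(1)[of n] by simp
    have "d_n (Suc n) G G' / (1 + d_n (Suc n) G G') \<le> d_n (Suc n) G G' / 1"
      using d(1)[of n] by (intro divide_left_mono) auto
    then show "?t n \<le> (1/2) ^ Suc n * c" using d(2)[of n] by (intro mult_left_mono) auto
  qed
  have s: "(\<lambda>n. (1/2) ^ Suc n * c) sums (1 * c)"
    by (intro sums_mult2 power_half_series)
  have "summable ?t"
    by (rule summable_comparison_test'[OF sums_summable[OF s], of 0])
      (simp only: real_norm_def abs_of_nonneg[OF bd(1)], rule bd(2))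
  then have "suminf ?t \<le> (\<Sum>n. (1/2) ^ Suc n * c)"
    by (rule suminf_le[OF bd(2) _ sums_summable[OF s]])
  also have "\<dots> = c" using sums_unique[OF s] by simp
  finally show ?thesis by (simp only: d_S_def)
qed

theorem theorem2p1:
  fixes \<beta> m0 :: real and \<mu> \<nu> :: "real measure"
  assumes "0 < m0" "m0 \<le> \<beta>"
    and "\<mu> \<in> Prob_on 0 \<beta>" "\<nu> \<in> Prob_on 0 \<beta>"
    and "(\<integral>k. k \<partial>\<mu>) = (\<integral>k. k \<partial>\<nu>)" "(\<integral>k. k \<partial>\<mu>) \<ge> m0"
  shows "(\<forall>\<phi>. boundary_datum \<phi> \<longrightarrow>
            (\<exists>G. is_solution \<mu> \<nu> \<phi> G \<and>
                 (\<forall>G'. is_solution \<mu> \<nu> \<phi> G' \<longrightarrow> (\<forall>p\<in>S_set. G' p = G p))))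
      \<and> (\<forall>\<phi>. boundary_datum \<phi> \<longrightarrow> (\<forall>e>0. \<exists>d>0. \<forall>\<phi>'. boundary_datum \<phi>' \<longrightarrow>
            d_infty \<phi> \<phi>' < d \<longrightarrow>
            (\<forall>G G'. is_solution \<mu> \<nu> \<phi> G \<longrightarrow> is_solution \<mu> \<nu> \<phi>' G' \<longrightarrow> d_S G G' < e)))"
proof -
  \<comment> \<open>The parameter \<open>m\<close> is the common mean; its positivity and that of
    \<open>\<beta>\<close> come from \<open>m0\<close>.\<close>
  interpret urn \<beta> "\<integral>k. k \<partial>\<mu>" \<mu> \<nu>
    using assms by unfold_locales auto
  show ?thesis
  proof (intro conjI allI impI)
    fix \<phi> assume \<phi>: "boundary_datum \<phi>"
    obtain G where G: "is_solution \<mu> \<nu> \<phi> G"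
      using solution_exists[OF \<phi>] by (auto simp: is_solution_iff)
    have "G' p = G p" if G': "is_solution \<mu> \<nu> \<phi> G'" and p: "p \<in> S_set" for G' p
    proof -
      have P: "G' p \<in> Prob_on 0 1" "G p \<in> Prob_on 0 1"
        using G G' p by (auto simp: is_solution_def intro: cont_SD)
      have "dW (G' p) (G p) \<le> 0"
        by (rule solutions_dW_le[OF \<phi> \<phi> G' G _ p]) (simp add: dW_refl)
      then show ?thesis using dW_nonneg[OF P] dW_eq_0D[OF P] by simp
    qed
    then show "\<exists>G. is_solution \<mu> \<nu> \<phi> G \<and> (\<forall>G'. is_solution \<mu> \<nu> \<phi> G' \<longrightarrow> (\<forall>p\<in>S_set. G' p = G p))"
      using G by blast
  next
    fix \<phi> and e :: real assume \<phi>: "boundary_datum \<phi>" and e: "e > 0"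
    \<comment> \<open>The solution map is 1-Lipschitz, so \<open>e\<close> itself serves as the
      required \<open>d\<close>.\<close>
    have "d_S G G' < e" if \<phi>': "boundary_datum \<phi>'" and d: "d_infty \<phi> \<phi>' < e"
      and G: "is_solution \<mu> \<nu> \<phi> G" and G': "is_solution \<mu> \<nu> \<phi>' G'" for \<phi>' G G'
    proof -
      have "d_S G G' \<le> d_infty \<phi> \<phi>'"
        using G G' by (intro d_S_le solutions_dW_le[OF \<phi> \<phi>' G G'] dW_le_d_infty \<phi> \<phi>') (auto simp: is_solution_def)
      then show ?thesis using d by simp
    qed
    then show "\<exists>d>0. \<forall>\<phi>'. boundary_datum \<phi>' \<longrightarrow> d_infty \<phi> \<phi>' < d \<longrightarrow>
        (\<forall>G G'. is_solution \<mu> \<nu> \<phi> G \<longrightarrow> is_solution \<mu> \<nu> \<phi>' G' \<longrightarrow> d_S G G' < e)"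
      using e by blast
  qed
qed

end
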